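(* Let $G$ be a cycle of length $n$. If $n$ is even, then $\varepsilon(I(G))=0$. If $n$ is odd, then $$\varepsilon(I(G))=\frac{2}{n+1}.$$
   Context: A cycle of length $n\ge3$ is the simple graph with nodes $x_1,\dots,x_n$ and edges $\{x_1,x_2\},\{x_2,x_3\},\dots,\{x_{n-1},x_n\},\{x_n,x_1\}$. Fix a field $\Bbbk$ and view nodes as indeterminates; the edge ideal is $I(G)=(x_ix_j:\{x_i,x_j\}\text{ an edge of }G)\subset R=\Bbbk[x_1,\dots,x_n]_{(x_1,\dots,x_n)}$. For an ideal $I$ in a Noetherian local ring $(R,\mathfrak m)$ of dimension $n$, the $\varepsilon$-multiplicity is $$\varepsilon(I)=n!\,\limsup_{t\to\infty}\frac{\lambda_R(\Gamma_{\mathfrak m}(R/I^t))}{t^n},$$ where $\lambda_R$ is length and $\Gamma_{\mathfrak m}$ is the zeroth local cohomology. *)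

theory Defs
  imports
    "HOL-Algebra.Ideal_Product"
    "HOL-Algebra.QuotRing"
    "HOL-Algebra.Module"
    "HOL-Library.Poly_Mapping"
    "HOL-Library.Extended_Real"
    "HOL-Computational_Algebra.Fraction_Field"
begin

section \<open>Notions for commutative rings and modules\<close>

abbreviation ideal_power :: "('a, 'b) ring_scheme \<Rightarrow> 'a set \<Rightarrow> nat \<Rightarrow> 'a set" where
  "ideal_power R I t \<equiv> I [^]\<^bsub>ideals_set R\<^esub> t"

definition krull_dim :: "('a, 'b) ring_scheme \<Rightarrow> enat" where
  "krull_dim R = Sup {enat l | l. \<exists>P. (\<forall>i\<le>l. primeideal (P i) R) \<and> (\<forall>i<l. P i \<subset> P (Suc i))}"

definition module_length :: "('a, 'b) ring_scheme \<Rightarrow> ('a, 'c, 'd) module_scheme \<Rightarrow> enat" where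
  "module_length R M =
     Sup {enat l | l. \<exists>N. (\<forall>i\<le>l. submodule (N i) R M) \<and> (\<forall>i<l. N i \<subset> N (Suc i))}"

definition quot_module :: "('a, 'b) ring_scheme \<Rightarrow> 'a set \<Rightarrow> ('a, 'a set) module" where
  "quot_module R J =
     \<lparr>carrier = carrier (R Quot J), mult = mult (R Quot J), one = one (R Quot J),
      zero = zero (R Quot J), add = add (R Quot J),
      smult = (\<lambda>a X. (J +>\<^bsub>R\<^esub> a) \<otimes>\<^bsub>R Quot J\<^esub> X)\<rparr>"

text \<open>The zeroth local cohomology \<open>\<Gamma>\<^sub>J(M)\<close>: the submodule of elements annihilated by some power of \<open>J\<close>.\<close>

definition local_cohomology0 ::
    "('a, 'b) ring_scheme \<Rightarrow> 'a set \<Rightarrow> ('a, 'c) module \<Rightarrow> ('a, 'c) module" where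
  "local_cohomology0 R J M =
     M\<lparr>carrier := {x \<in> carrier M. \<exists>k. \<forall>a\<in>ideal_power R J k. a \<odot>\<^bsub>M\<^esub> x = \<zero>\<^bsub>M\<^esub>}\<rparr>"

text \<open>Meaningful for local rings only.\<close>

definition max_ideal :: "('a, 'b) ring_scheme \<Rightarrow> 'a set" where
  "max_ideal R = (THE M. maximalideal M R)"

text \<open>
  Intended for a Noetherian local ring \<open>R\<close>, whose Krull dimension is finite and for which
  all the lengths below are finite. The value at \<open>t = 0\<close> is irrelevant for the limit superior.
\<close>

definition eps_multiplicity :: "('a, 'b) ring_scheme \<Rightarrow> 'a set \<Rightarrow> ereal" where
  "eps_multiplicity R I =
     (let d = the_enat (krull_dim R) in
        ereal (fact d) *
        limsup (\<lambda>t. ereal_of_enat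
                      (module_length R
                        (local_cohomology0 R (max_ideal R) (quot_module R (ideal_power R I t))))
                    / ereal (real t ^ d)))"


section \<open>The local ring of affine space at the origin\<close>

text \<open>
  A polynomial is a finitely supported map from monomials to coefficients, and a monomial
  a finitely supported map from variable indices to exponents.
\<close>

type_synonym 'k polynomial = "(nat \<Rightarrow>\<^sub>0 nat) \<Rightarrow>\<^sub>0 'k"

definition poly_var :: "nat \<Rightarrow> 'k::field polynomial" where
  "poly_var i = Poly_Mapping.single (Poly_Mapping.single i 1) 1"

definition polys_in :: "nat \<Rightarrow> 'k::field polynomial set" where
  "polys_in n = {p. \<forall>m\<in>Poly_Mapping.keys p. Poly_Mapping.keys m \<subseteq> {1..n}}"

text \<open>
  The localization of \<open>k[x\<^sub>1, \<dots>, x\<^sub>n]\<close> at \<open>(x\<^sub>1, \<dots>, x\<^sub>n)\<close>, realised inside a field of fractions: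
  a polynomial lies outside \<open>(x\<^sub>1, \<dots>, x\<^sub>n)\<close> iff its coefficient at the monomial \<open>1\<close>, which has
  exponent vector \<open>0\<close>, is nonzero.
\<close>

definition local_poly_ring :: "nat \<Rightarrow> 'k::field polynomial fract ring" where
  "local_poly_ring n =
     \<lparr>carrier = {Fract p q | p q. p \<in> polys_in n \<and> q \<in> polys_in n \<and> Poly_Mapping.lookup q 0 \<noteq> 0},
      mult = (*), one = 1, zero = 0, add = (+)\<rparr>"


section \<open>Edge ideals\<close>

definition edge_ideal :: "nat \<Rightarrow> nat set set \<Rightarrow> 'k::field polynomial fract set" where
  "edge_ideal n E =
     Idl\<^bsub>local_poly_ring n\<^esub> {Fract (poly_var i * poly_var j) 1 | i j. {i, j} \<in> E}"

definition cycle_edges :: "nat \<Rightarrow> nat set set" where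
  "cycle_edges n = {{i, i + 1} | i. 1 \<le> i \<and> i < n} \<union> {{n, 1}}"

end

theory Submission
  imports Defs
begin

text \<open>
  For a monomial ideal, membership in the local ring is decided by exponent vectors, so the length of
  \<open>\<Gamma>(R/I\<^sup>t)\<close> is the number of monomials in the saturation of \<open>I\<^sup>t\<close> but not in
  \<open>I\<^sup>t\<close>. A monomial \<open>x\<^sup>a\<close> lies in \<open>I\<^sup>t\<close> iff \<open>t\<close> edges, counted
  with multiplicity, fit below the vertex capacities \<open>a\<close>. On a cycle this is a min-max problem: it
  holds iff every vertex cover has weight at least \<open>t\<close> and \<open>|a| \<ge> 2t\<close>. The covers
  are insensitive to saturation, because a minimal cover omits some vertex, whose capacity may then be
  raised freely. For even \<open>n\<close> the degree condition follows from the two bipartition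
  covers, so the saturation adds nothing. For \<open>n = 2k + 1\<close> the added monomials are exactly
  \<open>(x\<^sub>1 \<dots> x\<^sub>n)\<^sup>d\<close> times a product of \<open>t - (k + 1) d\<close> edges with
  \<open>d \<ge> 1\<close>, where \<open>d\<close> and the edges are unique; so there are
  \<open>\<Sum>d\<ge>1. (t - (k + 1) d + n - 1) choose (n - 1)\<close> of them, which is asymptotic to
  \<open>t\<^sup>n / ((k + 1) n!)\<close>.
\<close>

section \<open>Monomial ideals of the local ring\<close>

text \<open>Length and dimension are defined by chains, so both are computed from chains. Chains of
  submodules become chains of k-subspaces of the span of finitely many monomials, because constants
  act and denominators are units; adding monomials one at a time, highest degree first, attains the
  bound. Chains of primes are bounded by an algebraic relation between any n + 1 elements, found by
  counting monomials; the dimension fixes both the power of t and the factorial.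

  The obstacle in the min-max step is that an odd cycle is not bipartite, so covers alone do not
  control a packing: with all capacities 1, every cover has weight at least k + 1 but only k edges
  fit. The degree condition closes this gap, and the proof fixes the multiplicity of one edge before
  packing the remaining path. The same gap is the origin of the factor k + 1: a unit of d raises
  every cover weight by at least k + 1, but the degree by only 2k + 1, one short of twice
  that.\<close>

lemma lookup_times_keys:
  fixes f g :: "'a::monoid_add \<Rightarrow>\<^sub>0 'b::semiring_0"
  shows "Poly_Mapping.lookup (f * g) k =
    (\<Sum>a\<in>Poly_Mapping.keys f. \<Sum>b\<in>Poly_Mapping.keys g.
       if a + b = k then Poly_Mapping.lookup f a * Poly_Mapping.lookup g b else 0)"
proof -
  have inner: "(\<Sum>q. Poly_Mapping.lookup g q when k = l + q) =
      (\<Sum>b\<in>Poly_Mapping.keys g. if l + b = k then Poly_Mapping.lookup g b else 0)" for l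
    by (subst Sum_any.expand_superset[of "Poly_Mapping.keys g"])
      (auto simp: in_keys_iff when_def intro!: sum.cong)
  show ?thesis
    unfolding lookup_mult inner
    by (subst Sum_any.expand_superset[of "Poly_Mapping.keys f"])
      (auto simp: in_keys_iff sum_distrib_left intro!: sum.cong)
qed

lemma keys_times_subset:
  fixes f g :: "'a::monoid_add \<Rightarrow>\<^sub>0 'b::semiring_0"
  assumes "\<And>a b. a \<in> Poly_Mapping.keys f \<Longrightarrow> b \<in> Poly_Mapping.keys g \<Longrightarrow> a + b \<in> S"
  shows "Poly_Mapping.keys (f * g) \<subseteq> S"
  using assms keys_mult[of f g] by blast

lemma keys_plus_subset:
  "Poly_Mapping.keys f \<subseteq> S \<Longrightarrow> Poly_Mapping.keys g \<subseteq> S \<Longrightarrow> Poly_Mapping.keys (f + g) \<subseteq> S"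
  using keys_add[of f g] by blast

lemma keys_uminus_eq [simp]:
  fixes f :: "'a \<Rightarrow>\<^sub>0 'b::ab_group_add"
  shows "Poly_Mapping.keys (- f) = Poly_Mapping.keys f"
  by (auto simp: in_keys_iff)

lemma keys_minus_subset:
  fixes f g :: "'a \<Rightarrow>\<^sub>0 'b::ab_group_add"
  shows "Poly_Mapping.keys f \<subseteq> S \<Longrightarrow> Poly_Mapping.keys g \<subseteq> S \<Longrightarrow> Poly_Mapping.keys (f - g) \<subseteq> S"
  using keys_plus_subset[of f S "- g"] by simp

lemma sum_single_keys:
  fixes p :: "'a \<Rightarrow>\<^sub>0 'b::comm_monoid_add"
  assumes "finite A" "Poly_Mapping.keys p \<subseteq> A"
  shows "(\<Sum>a\<in>A. Poly_Mapping.single a (Poly_Mapping.lookup p a)) = p"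
proof (rule poly_mapping_eqI)
  fix k
  have "Poly_Mapping.lookup (\<Sum>a\<in>A. Poly_Mapping.single a (Poly_Mapping.lookup p a)) k
      = (\<Sum>a\<in>A. if a = k then Poly_Mapping.lookup p a else 0)"
    by (auto simp: lookup_sum lookup_single when_def intro!: sum.cong)
  also have "\<dots> = Poly_Mapping.lookup p k"
    using assms by (auto simp: in_keys_iff)
  finally show "Poly_Mapping.lookup (\<Sum>a\<in>A. Poly_Mapping.single a (Poly_Mapping.lookup p a)) k
    = Poly_Mapping.lookup p k" .
qed

definition restrict_keys :: "'a set \<Rightarrow> ('a \<Rightarrow>\<^sub>0 'b::comm_monoid_add) \<Rightarrow> 'a \<Rightarrow>\<^sub>0 'b" where
  "restrict_keys S p = (\<Sum>a\<in>Poly_Mapping.keys p \<inter> S. Poly_Mapping.single a (Poly_Mapping.lookup p a))"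

lemma lookup_restrict_keys:
  "Poly_Mapping.lookup (restrict_keys S p) k = (if k \<in> S then Poly_Mapping.lookup p k else 0)"
proof -
  have "Poly_Mapping.lookup (restrict_keys S p) k
      = (\<Sum>a\<in>Poly_Mapping.keys p \<inter> S. if a = k then Poly_Mapping.lookup p a else 0)"
    by (auto simp: restrict_keys_def lookup_sum lookup_single when_def intro!: sum.cong)
  then show ?thesis by (auto simp: in_keys_iff)
qed

lemma keys_restrict_keys: "Poly_Mapping.keys (restrict_keys S p) = Poly_Mapping.keys p \<inter> S"
  by (auto simp: in_keys_iff lookup_restrict_keys split: if_splits)

lemma restrict_keys_split:
  fixes p :: "'a \<Rightarrow>\<^sub>0 'b::comm_monoid_add"
  shows "p = restrict_keys S p + restrict_keys (- S) p"
  by (rule poly_mapping_eqI) (simp add: lookup_add lookup_restrict_keys)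

section \<open>Exponent vectors, degrees and constant coefficients\<close>

definition exps :: "nat \<Rightarrow> (nat \<Rightarrow>\<^sub>0 nat) set" where
  "exps n = {a. Poly_Mapping.keys a \<subseteq> {1..n}}"

definition mdeg :: "nat \<Rightarrow> (nat \<Rightarrow>\<^sub>0 nat) \<Rightarrow> nat" where
  "mdeg n a = (\<Sum>i\<in>{1..n}. Poly_Mapping.lookup a i)"

lemma polys_in_exps: "p \<in> polys_in n \<longleftrightarrow> Poly_Mapping.keys p \<subseteq> exps n"
  by (auto simp: polys_in_def exps_def)

lemma exps_0 [simp]: "0 \<in> exps n"
  by (simp add: exps_def)

lemma exps_add: "a \<in> exps n \<Longrightarrow> b \<in> exps n \<Longrightarrow> a + b \<in> exps n"
  by (simp add: exps_def keys_plus_subset)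

lemma mdeg_0 [simp]: "mdeg n 0 = 0"
  by (simp add: mdeg_def)

lemma mdeg_add: "mdeg n (a + b) = mdeg n a + mdeg n b"
  by (simp add: mdeg_def lookup_add sum.distrib)

lemma mdeg_eq_0_iff: "a \<in> exps n \<Longrightarrow> mdeg n a = 0 \<longleftrightarrow> a = 0"
  by (auto simp: mdeg_def exps_def in_keys_iff intro!: poly_mapping_eqI)

lemma exps_add_eq_0: "(a::nat \<Rightarrow>\<^sub>0 nat) + b = 0 \<longleftrightarrow> a = 0 \<and> b = 0"
  by (auto simp: poly_mapping_eq_iff lookup_add fun_eq_iff)

text \<open>The form in which the coefficient formula for a product collapses when a single pair of
  exponents contributes; that pair may also lie outside the supports.\<close>

lemma sum_sum_delta:
  fixes f g :: "'a \<Rightarrow> 'b::semiring_0"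
  assumes "finite A" "finite B" "a0 \<notin> A \<Longrightarrow> f a0 = 0" "b0 \<notin> B \<Longrightarrow> g b0 = 0"
  shows "(\<Sum>a\<in>A. \<Sum>b\<in>B. if b = b0 then if a = a0 then f a * g b else 0 else 0) = f a0 * g b0"
proof (cases "b0 \<in> B")
  case True
  then show ?thesis using assms by (cases "a0 \<in> A") simp_all
qed (use assms in simp)

lemma lookup_times_0:
  fixes p q :: "'k::field polynomial"
  shows "Poly_Mapping.lookup (p * q) 0 = Poly_Mapping.lookup p 0 * Poly_Mapping.lookup q 0"
proof -
  have "Poly_Mapping.lookup (p * q) 0 =
    (\<Sum>a\<in>Poly_Mapping.keys p. \<Sum>b\<in>Poly_Mapping.keys q.
       if b = 0 then if a = 0 then Poly_Mapping.lookup p a * Poly_Mapping.lookup q b else 0 else 0)"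
    unfolding lookup_times_keys by (intro sum.cong refl) (simp add: exps_add_eq_0)
  also have "\<dots> = Poly_Mapping.lookup p 0 * Poly_Mapping.lookup q 0"
    by (rule sum_sum_delta) (simp_all add: in_keys_iff)
  finally show ?thesis .
qed

lemma polys_in_times: "p \<in> polys_in n \<Longrightarrow> q \<in> polys_in n \<Longrightarrow> p * q \<in> polys_in n"
  unfolding polys_in_exps by (rule keys_times_subset) (blast intro: exps_add)

lemma polys_in_single: "a \<in> exps n \<Longrightarrow> Poly_Mapping.single a c \<in> polys_in n"
  unfolding polys_in_exps by simp

lemma polys_in_1 [simp]: "1 \<in> polys_in n" and polys_in_0 [simp]: "0 \<in> polys_in n"
  unfolding polys_in_exps by simp_all

section \<open>Up-closed exponent sets and the ideals they define\<close>

definition upset :: "nat \<Rightarrow> (nat \<Rightarrow>\<^sub>0 nat) set \<Rightarrow> bool" where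
  "upset n S \<longleftrightarrow> S \<subseteq> exps n \<and> (\<forall>a\<in>S. \<forall>b\<in>exps n. a + b \<in> S)"

lemma upsetD: "upset n S \<Longrightarrow> a \<in> S \<Longrightarrow> b \<in> exps n \<Longrightarrow> a + b \<in> S"
  and upset_exps: "upset n S \<Longrightarrow> S \<subseteq> exps n"
  by (auto simp: upset_def)

lemma upset_exps_self: "upset n (exps n)"
  by (auto simp: upset_def exps_add)

text \<open>Only the numerator is constrained, and one suitable representation suffices; for
  up-closed sets the representation turns out not to matter. The empty set gives the zero ideal and
  \<open>exps n\<close> the whole ring.\<close>

definition mono_ideal :: "nat \<Rightarrow> (nat \<Rightarrow>\<^sub>0 nat) set \<Rightarrow> 'k::field polynomial fract set" where
  "mono_ideal n S = {Fract p q | p q. p \<in> polys_in n \<and> q \<in> polys_in n \<and>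
     Poly_Mapping.lookup q 0 \<noteq> 0 \<and> Poly_Mapping.keys p \<subseteq> S}"

lemma mono_idealI:
  "upset n S \<Longrightarrow> Poly_Mapping.keys p \<subseteq> S \<Longrightarrow> q \<in> polys_in n \<Longrightarrow> Poly_Mapping.lookup q 0 \<noteq> 0
    \<Longrightarrow> Fract p q \<in> mono_ideal n S"
  unfolding mono_ideal_def polys_in_exps by (blast dest: upset_exps)

lemma mono_idealE:
  assumes "x \<in> mono_ideal n S"
  obtains p q where "x = Fract p q" "p \<in> polys_in n" "q \<in> polys_in n"
    "Poly_Mapping.lookup q 0 \<noteq> 0" "q \<noteq> 0" "Poly_Mapping.keys p \<subseteq> S"
  using assms unfolding mono_ideal_def by fastforce

text \<open>The multiplier \<open>q\<close> is a unit of the local ring; it can be cancelled by looking at a monomial of least degree outside \<open>S\<close>.\<close>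

lemma keys_subset_of_times:
  fixes p q :: "'k::field polynomial"
  assumes S: "upset n S" and p: "p \<in> polys_in n" and q: "q \<in> polys_in n"
    and q0: "Poly_Mapping.lookup q 0 \<noteq> 0" and pq: "Poly_Mapping.keys (p * q) \<subseteq> S"
  shows "Poly_Mapping.keys p \<subseteq> S"
proof (rule ccontr)
  assume "\<not> Poly_Mapping.keys p \<subseteq> S"
  then have ne: "Poly_Mapping.keys p - S \<noteq> {}" and fin: "finite (Poly_Mapping.keys p - S)" by auto
  obtain a where a: "a \<in> Poly_Mapping.keys p" "a \<notin> S"
    and min: "\<And>b. b \<in> Poly_Mapping.keys p \<Longrightarrow> b \<notin> S \<Longrightarrow> mdeg n a \<le> mdeg n b"
    using arg_min_if_finite[OF fin ne, of "mdeg n"] by (metis DiffD1 DiffD2 DiffI not_less)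
  \<comment> \<open>A contributing exponent \<open>b\<close> inside \<open>S\<close> would pull
    \<open>a\<close> into \<open>S\<close>, and one outside \<open>S\<close> cannot have smaller
    degree than \<open>a\<close>; so only the constant term of \<open>q\<close> contributes at
    \<open>a\<close>.\<close>
  have *: "b = a \<and> d = 0" if "b \<in> Poly_Mapping.keys p" "d \<in> Poly_Mapping.keys q" "b + d = a" for b d
  proof -
    have d: "d \<in> exps n" using that(2) q by (auto simp: polys_in_exps)
    have "b \<notin> S" using upsetD[OF S _ d, of b] that(3) a(2) by auto
    then have "mdeg n a \<le> mdeg n b" using min that(1) by blast
    moreover have "mdeg n a = mdeg n b + mdeg n d" using that(3) mdeg_add by metis
    ultimately have "d = 0" using mdeg_eq_0_iff[OF d] by simp
    then show ?thesis using that(3) by simp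
  qed
  have "Poly_Mapping.lookup (p * q) a =
    (\<Sum>b\<in>Poly_Mapping.keys p. \<Sum>d\<in>Poly_Mapping.keys q.
       if d = 0 then if b = a then Poly_Mapping.lookup p b * Poly_Mapping.lookup q d else 0 else 0)"
    unfolding lookup_times_keys by (intro sum.cong refl) (auto dest: *)
  also have "\<dots> = Poly_Mapping.lookup p a * Poly_Mapping.lookup q 0"
    by (rule sum_sum_delta) (simp_all add: in_keys_iff)
  also have "\<dots> \<noteq> 0" using a(1) q0 by (simp add: in_keys_iff)
  finally have "a \<in> Poly_Mapping.keys (p * q)" by (simp add: in_keys_iff)
  then show False using pq a(2) by blast
qed

lemma Fract_in_mono_ideal_iff:
  fixes p q :: "'k::field polynomial"
  assumes S: "upset n S" and p: "p \<in> polys_in n" and q: "q \<in> polys_in n"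
    and q0: "Poly_Mapping.lookup q 0 \<noteq> 0"
  shows "Fract p q \<in> mono_ideal n S \<longleftrightarrow> Poly_Mapping.keys p \<subseteq> S"
proof
  assume "Fract p q \<in> mono_ideal n S"
  then obtain p' q' where eq: "Fract p q = Fract p' q'" and q': "q' \<in> polys_in n" "q' \<noteq> 0"
      "Poly_Mapping.lookup q' 0 \<noteq> 0" and p': "p' \<in> polys_in n" "Poly_Mapping.keys p' \<subseteq> S"
    by (elim mono_idealE) blast
  have "q \<noteq> 0" using q0 by auto
  then have "p * q' = p' * q" using eq q'(2) by (simp add: eq_fract)
  moreover have "Poly_Mapping.keys (p' * q) \<subseteq> S"
    using p' q upsetD[OF S] unfolding polys_in_exps by (intro keys_times_subset) blast
  ultimately show "Poly_Mapping.keys p \<subseteq> S"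
    using keys_subset_of_times[OF S p q'(1,3)] by simp
qed (use assms in \<open>auto intro: mono_idealI\<close>)

lemma local_poly_ring_simps [simp]:
  "mult (local_poly_ring n) = (*)" "one (local_poly_ring n) = 1"
  "zero (local_poly_ring n) = 0" "add (local_poly_ring n) = (+)"
  by (simp_all add: local_poly_ring_def)

lemma carrier_local_poly_ring: "carrier (local_poly_ring n) = mono_ideal n (exps n)"
  unfolding local_poly_ring_def mono_ideal_def polys_in_exps by auto

lemma mono_ideal_add:
  fixes x y :: "'k::field polynomial fract"
  assumes S: "upset n S" and x: "x \<in> mono_ideal n S" and y: "y \<in> mono_ideal n S"
  shows "x + y \<in> mono_ideal n S"
proof -
  obtain p q where x': "x = Fract p q" "p \<in> polys_in n" "q \<in> polys_in n"
    "Poly_Mapping.lookup q 0 \<noteq> 0" "q \<noteq> 0" "Poly_Mapping.keys p \<subseteq> S" using x by (rule mono_idealE)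
  obtain r s where y': "y = Fract r s" "r \<in> polys_in n" "s \<in> polys_in n"
    "Poly_Mapping.lookup s 0 \<noteq> 0" "s \<noteq> 0" "Poly_Mapping.keys r \<subseteq> S" using y by (rule mono_idealE)
  have "Poly_Mapping.keys (p * s + r * q) \<subseteq> S"
    using x'(3,6) y'(3,6) upsetD[OF S] unfolding polys_in_exps
    by (intro keys_plus_subset keys_times_subset) blast+
  then show ?thesis using x' y' S
    by (auto simp: lookup_times_0 intro!: mono_idealI polys_in_times)
qed

lemma mono_ideal_times:
  fixes x y :: "'k::field polynomial fract"
  assumes U: "upset n U" and ST: "\<And>a b. a \<in> S \<Longrightarrow> b \<in> T \<Longrightarrow> a + b \<in> U"
    and x: "x \<in> mono_ideal n S" and y: "y \<in> mono_ideal n T"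
  shows "x * y \<in> mono_ideal n U"
proof -
  obtain p q where x': "x = Fract p q" "p \<in> polys_in n" "q \<in> polys_in n"
    "Poly_Mapping.lookup q 0 \<noteq> 0" "q \<noteq> 0" "Poly_Mapping.keys p \<subseteq> S" using x by (rule mono_idealE)
  obtain r s where y': "y = Fract r s" "r \<in> polys_in n" "s \<in> polys_in n"
    "Poly_Mapping.lookup s 0 \<noteq> 0" "s \<noteq> 0" "Poly_Mapping.keys r \<subseteq> T" using y by (rule mono_idealE)
  have "Poly_Mapping.keys (p * r) \<subseteq> U"
    using x' y' ST by (intro keys_times_subset) auto
  then show ?thesis using x' y' U
    by (auto simp: lookup_times_0 intro!: mono_idealI polys_in_times)
qed

lemma mono_ideal_uminus:
  fixes x :: "'k::field polynomial fract"
  assumes S: "upset n S" and x: "x \<in> mono_ideal n S"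
  shows "- x \<in> mono_ideal n S"
  using x S by (elim mono_idealE) (auto intro!: mono_idealI)

lemma mono_ideal_mono: "S \<subseteq> T \<Longrightarrow> mono_ideal n S \<subseteq> mono_ideal n T"
  unfolding mono_ideal_def by blast

lemma zero_in_mono_ideal [simp]: "(0 :: 'k::field polynomial fract) \<in> mono_ideal n S"
proof -
  have "Fract 0 1 \<in> (mono_ideal n S :: 'k polynomial fract set)"
    unfolding mono_ideal_def
    by (rule CollectI, rule exI[of _ 0], rule exI[of _ 1]) simp
  then show ?thesis by (simp add: Zero_fract_def)
qed

lemma cring_local_poly_ring: "cring (local_poly_ring n :: 'k::field polynomial fract ring)"
proof (rule cringI)
  let ?R = "local_poly_ring n :: 'k polynomial fract ring"
  have one: "1 \<in> carrier ?R"
    by (auto simp: carrier_local_poly_ring One_fract_def intro!: mono_idealI upset_exps_self)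
  show "abelian_group ?R"
  proof (rule abelian_groupI)
    fix x assume "x \<in> carrier ?R"
    then show "\<exists>y\<in>carrier ?R. y \<oplus>\<^bsub>?R\<^esub> x = \<zero>\<^bsub>?R\<^esub>"
      using mono_ideal_uminus[OF upset_exps_self]
      by (intro bexI[of _ "- x"]) (auto simp: carrier_local_poly_ring)
  qed (auto simp: carrier_local_poly_ring mono_ideal_add upset_exps_self add_ac)
  show "Group.comm_monoid ?R"
    by (rule comm_monoidI)
      (use one in \<open>auto simp: carrier_local_poly_ring mult_ac
        intro: mono_ideal_times[OF upset_exps_self exps_add]\<close>)
qed (auto simp: algebra_simps)

lemma ideal_mono_ideal:
  assumes S: "upset n S"
  shows "ideal (mono_ideal n S :: 'k::field polynomial fract set) (local_poly_ring n)"
proof -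
  interpret cring "local_poly_ring n :: 'k polynomial fract ring" by (rule cring_local_poly_ring)
  have sub: "mono_ideal n S \<subseteq> carrier (local_poly_ring n :: 'k polynomial fract ring)"
    using mono_ideal_mono[OF upset_exps[OF S]] by (auto simp: carrier_local_poly_ring)
  show ?thesis
  proof (rule idealI)
    show "subgroup (mono_ideal n S) (add_monoid (local_poly_ring n :: 'k polynomial fract ring))"
    proof (rule add.subgroupI)
      fix a :: "'k polynomial fract" assume a: "a \<in> mono_ideal n S"
      have "\<ominus>\<^bsub>local_poly_ring n\<^esub> a = - a"
      proof (rule minus_equality)
        show "- a \<in> carrier (local_poly_ring n)" "a \<in> carrier (local_poly_ring n)"
          using a sub mono_ideal_uminus[OF S a] by auto
      qed simp
      then show "\<ominus>\<^bsub>local_poly_ring n\<^esub> a \<in> mono_ideal n S"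
        using mono_ideal_uminus[OF S a] by simp
    next
      show "mono_ideal n S \<noteq> ({} :: 'k polynomial fract set)" using zero_in_mono_ideal by blast
    qed (use sub in \<open>auto simp: mono_ideal_add[OF S]\<close>)
    fix a x :: "'k polynomial fract"
    assume "a \<in> mono_ideal n S" "x \<in> carrier (local_poly_ring n)"
    then have "a * x \<in> mono_ideal n S"
      unfolding carrier_local_poly_ring by (intro mono_ideal_times[OF S]) (auto intro: upsetD[OF S])
    then show "a \<otimes>\<^bsub>local_poly_ring n\<^esub> x \<in> mono_ideal n S" "x \<otimes>\<^bsub>local_poly_ring n\<^esub> a \<in> mono_ideal n S"
      by (simp_all add: mult.commute)
  qed (rule ring_axioms)
qed

lemma
  fixes I :: "'k::field polynomial fract set"
  assumes I: "ideal I (local_poly_ring n)"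
  shows ideal_zero: "0 \<in> I"
    and ideal_plus: "x \<in> I \<Longrightarrow> y \<in> I \<Longrightarrow> x + y \<in> I"
    and ideal_times: "x \<in> mono_ideal n (exps n) \<Longrightarrow> y \<in> I \<Longrightarrow> x * y \<in> I"
    and ideal_subset: "I \<subseteq> mono_ideal n (exps n)"
    and ideal_one: "1 \<in> I \<Longrightarrow> I = mono_ideal n (exps n)"
proof -
  interpret ideal I "local_poly_ring n :: 'k polynomial fract ring" by fact
  show "0 \<in> I" using additive_subgroup.zero_closed[OF ideal.axioms(1)[OF I]] by simp
  show "x \<in> I \<Longrightarrow> y \<in> I \<Longrightarrow> x + y \<in> I"
    using additive_subgroup.a_closed[OF ideal.axioms(1)[OF I]] by simp
  show "x \<in> mono_ideal n (exps n) \<Longrightarrow> y \<in> I \<Longrightarrow> x * y \<in> I"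
    using I_l_closed by (simp add: carrier_local_poly_ring)
  show "I \<subseteq> mono_ideal n (exps n)" using Icarr carrier_local_poly_ring by blast
  show "1 \<in> I \<Longrightarrow> I = mono_ideal n (exps n)"
    using one_imp_carrier by (simp add: carrier_local_poly_ring)
qed

lemma ideal_uminus:
  fixes I :: "'k::field polynomial fract set"
  assumes I: "ideal I (local_poly_ring n)" and x: "x \<in> I"
  shows "- x \<in> I"
proof -
  have "1 \<in> (mono_ideal n (exps n) :: 'k polynomial fract set)"
    by (auto simp: One_fract_def intro!: mono_idealI upset_exps_self)
  from ideal_times[OF I mono_ideal_uminus[OF upset_exps_self this] x] show ?thesis by simp
qed

lemma Fract_add_same: "q \<noteq> 0 \<Longrightarrow> Fract (a + b) q = Fract a q + Fract b q"
  by (simp add: eq_fract algebra_simps)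

abbreviation monom_fract :: "(nat \<Rightarrow>\<^sub>0 nat) \<Rightarrow> 'k::field polynomial fract" where
  "monom_fract a \<equiv> Fract (Poly_Mapping.single a 1) 1"

lemma monom_fract_add: "monom_fract (a + b) = monom_fract a * monom_fract b"
  by (simp add: mult_single)

lemma monom_fract_in_mono_ideal_iff:
  assumes "upset n S" "a \<in> exps n"
  shows "(monom_fract a :: 'k::field polynomial fract) \<in> mono_ideal n S \<longleftrightarrow> a \<in> S"
  using assms by (subst Fract_in_mono_ideal_iff) (auto simp: polys_in_single)

text \<open>Each term of a numerator is a monomial times a constant over the common denominator, and
  that factor lies in the local ring, so the sum stays in the ideal.\<close>

lemma mono_ideal_subset_ideal:
  fixes I :: "'k::field polynomial fract set"
  assumes I: "ideal I (local_poly_ring n)" and S: "\<And>a. a \<in> S \<Longrightarrow> monom_fract a \<in> I"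
  shows "mono_ideal n S \<subseteq> I"
proof
  fix x :: "'k polynomial fract" assume "x \<in> mono_ideal n S"
  then obtain p q where x: "x = Fract p q" and p: "p \<in> polys_in n" "Poly_Mapping.keys p \<subseteq> S"
    and q: "q \<in> polys_in n" "Poly_Mapping.lookup q 0 \<noteq> 0" "q \<noteq> 0" by (rule mono_idealE)
  have summand: "Fract (Poly_Mapping.single a c) q \<in> I" if "a \<in> S" for a c
  proof -
    have "Fract (Poly_Mapping.single 0 c) q \<in> mono_ideal n (exps n)"
      using q by (intro mono_idealI upset_exps_self) auto
    from ideal_times[OF I this S[OF that]] show ?thesis by (simp add: mult_single)
  qed
  have "Fract (\<Sum>a\<in>A. Poly_Mapping.single a (Poly_Mapping.lookup p a)) q \<in> I"
    if "finite A" "A \<subseteq> S" for A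
    using that
  proof (induction A)
    case empty
    show ?case using ideal_zero[OF I] by (simp add: fract_collapse)
  next
    case (insert a A)
    have "Fract (Poly_Mapping.single a (Poly_Mapping.lookup p a)) q \<in> I"
      using insert.prems by (intro summand) simp
    from ideal_plus[OF I this insert.IH] insert show ?case
      by (simp add: Fract_add_same[OF \<open>q \<noteq> 0\<close>])
  qed
  from this[of "Poly_Mapping.keys p"] show "x \<in> I"
    using p by (simp add: x sum_single_keys)
qed

section \<open>Generators, products and powers in terms of exponents\<close>

definition msum :: "(nat \<Rightarrow>\<^sub>0 nat) set \<Rightarrow> (nat \<Rightarrow>\<^sub>0 nat) set \<Rightarrow> (nat \<Rightarrow>\<^sub>0 nat) set" where
  "msum S T = {a + b | a b. a \<in> S \<and> b \<in> T}"

text \<open>The zeroth power is all of \<open>exps n\<close>, matching the unit ideal, and each step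
  appends a factor on the right, as in \<open>ideal_power\<close>.\<close>

primrec mpow :: "nat \<Rightarrow> (nat \<Rightarrow>\<^sub>0 nat) set \<Rightarrow> nat \<Rightarrow> (nat \<Rightarrow>\<^sub>0 nat) set" where
  "mpow n S 0 = exps n"
| "mpow n S (Suc t) = msum (mpow n S t) S"

lemma upset_msum: "S \<subseteq> exps n \<Longrightarrow> upset n T \<Longrightarrow> upset n (msum S T)"
  unfolding upset_def msum_def by (fastforce intro: exps_add simp: add.assoc)

lemma upset_mpow: "upset n S \<Longrightarrow> upset n (mpow n S t)"
  by (induction t) (simp_all add: upset_exps_self upset_msum[OF upset_exps])

lemma ideal_prod_mono_ideal:
  assumes S: "upset n S" and T: "upset n T"
  shows "ideal_prod (local_poly_ring n) (mono_ideal n S) (mono_ideal n T) =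
    (mono_ideal n (msum S T) :: 'k::field polynomial fract set)" (is "?P = ?M")
proof
  interpret cring "local_poly_ring n :: 'k polynomial fract ring" by (rule cring_local_poly_ring)
  have ST: "upset n (msum S T)" using S T by (intro upset_msum upset_exps)
  show "?P \<subseteq> ?M"
  proof
    fix x assume "x \<in> ?P"
    then show "x \<in> ?M"
    proof induction
      case (prod i j)
      have "i * j \<in> ?M" by (rule mono_ideal_times[OF ST _ prod]) (auto simp: msum_def)
      then show ?case by simp
    next
      case (sum s1 s2)
      then show ?case by (simp add: mono_ideal_add[OF ST])
    qed
  qed
  have "monom_fract c \<in> ?P" if "c \<in> msum S T" for c
  proof -
    obtain a b where ab: "c = a + b" "a \<in> S" "b \<in> T" using \<open>c \<in> msum S T\<close> by (auto simp: msum_def)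
    have "monom_fract a \<otimes>\<^bsub>local_poly_ring n\<^esub> monom_fract b \<in> ?P"
      using ab upset_exps[OF S] upset_exps[OF T]
      by (intro ideal_prod.prod) (auto simp: monom_fract_in_mono_ideal_iff S T)
    then show ?thesis by (simp add: ab mult_single)
  qed
  then show "?M \<subseteq> ?P"
    by (intro mono_ideal_subset_ideal ideal_prod_is_ideal ideal_mono_ideal S T)
qed

lemma ideal_power_mono_ideal:
  assumes S: "upset n S"
  shows "ideal_power (local_poly_ring n) (mono_ideal n S) t =
    (mono_ideal n (mpow n S t) :: 'k::field polynomial fract set)"
proof (induction t)
  case 0
  show ?case by (simp add: nat_pow_def ideals_set_def carrier_local_poly_ring)
next
  case (Suc t)
  have "ideal_power (local_poly_ring n) (mono_ideal n S :: 'k polynomial fract set) (Suc t) =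
    ideal_prod (local_poly_ring n) (ideal_power (local_poly_ring n) (mono_ideal n S) t) (mono_ideal n S)"
    by (simp add: nat_pow_def ideals_set_def)
  then show ?case by (simp add: Suc.IH ideal_prod_mono_ideal upset_mpow S)
qed

lemma Idl_monom_fract:
  assumes G: "G \<subseteq> exps n"
  shows "Idl\<^bsub>local_poly_ring n\<^esub> (monom_fract ` G) =
    (mono_ideal n (msum G (exps n)) :: 'k::field polynomial fract set)" (is "?I = ?M")
proof
  interpret cring "local_poly_ring n :: 'k polynomial fract ring" by (rule cring_local_poly_ring)
  have up: "upset n (msum G (exps n))" using G by (intro upset_msum upset_exps_self)
  have sub: "G \<subseteq> msum G (exps n)" unfolding msum_def by force
  have car: "monom_fract ` G \<subseteq> carrier (local_poly_ring n :: 'k polynomial fract ring)"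
    using G by (auto simp: carrier_local_poly_ring monom_fract_in_mono_ideal_iff upset_exps_self)
  show "?I \<subseteq> ?M"
  proof (rule genideal_minimal[OF ideal_mono_ideal[OF up]])
    show "monom_fract ` G \<subseteq> ?M"
      using G sub by (auto simp: monom_fract_in_mono_ideal_iff[OF up subsetD[OF G]])
  qed
  have I: "ideal ?I (local_poly_ring n)" by (rule genideal_ideal[OF car])
  show "?M \<subseteq> ?I"
  proof (rule mono_ideal_subset_ideal[OF I])
    fix c assume "c \<in> msum G (exps n)"
    then obtain a b where ab: "c = b + a" "a \<in> G" "b \<in> exps n" by (auto simp: msum_def add.commute)
    have "monom_fract b \<in> (mono_ideal n (exps n) :: 'k polynomial fract set)"
      using ab by (simp add: monom_fract_in_mono_ideal_iff upset_exps_self)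
    moreover have "monom_fract a \<in> ?I" using genideal_self[OF car] ab by blast
    ultimately show "monom_fract c \<in> ?I"
      unfolding ab(1) monom_fract_add by (rule ideal_times[OF I])
  qed
qed

section \<open>The maximal ideal and its powers\<close>

lemma upset_nonzero: "upset n (exps n - {0})"
  by (auto simp: upset_def exps_add exps_add_eq_0)

text \<open>A fraction whose numerator has a nonzero constant term is a unit, with the flipped
  fraction as its inverse, and so cannot lie in a proper ideal.\<close>

lemma proper_ideal_subset_max:
  fixes I :: "'k::field polynomial fract set"
  assumes I: "ideal I (local_poly_ring n)" and ne: "I \<noteq> mono_ideal n (exps n)"
  shows "I \<subseteq> mono_ideal n (exps n - {0})"
proof
  fix x assume x: "x \<in> I"
  then obtain p q where x': "x = Fract p q" and p: "p \<in> polys_in n"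
    and q: "q \<in> polys_in n" "Poly_Mapping.lookup q 0 \<noteq> 0" "q \<noteq> 0"
    using ideal_subset[OF I] by (blast elim: mono_idealE)
  show "x \<in> mono_ideal n (exps n - {0})"
  proof (rule ccontr)
    assume "x \<notin> mono_ideal n (exps n - {0})"
    then have p0: "Poly_Mapping.lookup p 0 \<noteq> 0"
      using p q unfolding x' by (auto simp: Fract_in_mono_ideal_iff upset_nonzero polys_in_exps in_keys_iff)
    then have "p \<noteq> 0" by auto
    have "Fract q p \<in> mono_ideal n (exps n)"
      using p q p0 by (auto simp: polys_in_exps intro!: mono_idealI upset_exps_self)
    then have "Fract q p * x \<in> I" using ideal_times[OF I] x by blast
    also have "Fract q p * x = 1" using \<open>p \<noteq> 0\<close> q by (simp add: x' One_fract_def eq_fract mult.commute)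
    finally show False using ideal_one[OF I] ne by blast
  qed
qed

lemma one_notin_max: "1 \<notin> (mono_ideal n (exps n - {0}) :: 'k::field polynomial fract set)"
  unfolding One_fract_def by (subst Fract_in_mono_ideal_iff) (auto simp: upset_nonzero)

lemma one_in_mono_ideal_exps [simp]: "1 \<in> (mono_ideal n (exps n) :: 'k::field polynomial fract set)"
  unfolding One_fract_def by (subst Fract_in_mono_ideal_iff) (auto simp: upset_exps_self)

lemma max_ideal_local_poly_ring:
  "max_ideal (local_poly_ring n) = (mono_ideal n (exps n - {0}) :: 'k::field polynomial fract set)"
  unfolding max_ideal_def
proof (rule the_equality)
  let ?M = "mono_ideal n (exps n - {0}) :: 'k polynomial fract set"
  have ne: "?M \<noteq> mono_ideal n (exps n)" using one_notin_max one_in_mono_ideal_exps by blast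
  have sub: "?M \<subseteq> mono_ideal n (exps n)" by (rule mono_ideal_mono) auto
  show "maximalideal ?M (local_poly_ring n)"
  proof (rule maximalidealI[OF ideal_mono_ideal[OF upset_nonzero]])
    show "carrier (local_poly_ring n) \<noteq> ?M" using ne by (simp add: carrier_local_poly_ring)
    fix J :: "'k polynomial fract set"
    assume "ideal J (local_poly_ring n)" "?M \<subseteq> J"
    then show "J = ?M \<or> J = carrier (local_poly_ring n)"
      using proper_ideal_subset_max by (auto simp: carrier_local_poly_ring)
  qed
  fix J :: "'k polynomial fract set" assume J: "maximalideal J (local_poly_ring n)"
  interpret maximalideal J "local_poly_ring n :: 'k polynomial fract ring" by fact
  have "J \<subseteq> ?M" using proper_ideal_subset_max[OF is_ideal] I_notcarr by (auto simp: carrier_local_poly_ring)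
  then show "J = ?M"
    using I_maximal[OF ideal_mono_ideal[OF upset_nonzero]] ne sub by (auto simp: carrier_local_poly_ring)
qed

lemma mpow_nonzero: "mpow n (exps n - {0}) k = {a \<in> exps n. k \<le> mdeg n a}"
proof (induction k)
  case (Suc k)
  show ?case
  proof (intro equalityI subsetI)
    fix c assume "c \<in> mpow n (exps n - {0}) (Suc k)"
    then obtain a b where ab: "c = a + b" "a \<in> exps n" "k \<le> mdeg n a" "b \<in> exps n" "b \<noteq> 0"
      by (auto simp: Suc.IH msum_def)
    then have "mdeg n b \<noteq> 0" by (simp add: mdeg_eq_0_iff)
    then show "c \<in> {a \<in> exps n. Suc k \<le> mdeg n a}" using ab by (simp add: exps_add mdeg_add)
  next
    fix c assume "c \<in> {a \<in> exps n. Suc k \<le> mdeg n a}"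
    then have c: "c \<in> exps n" "Suc k \<le> mdeg n c" by auto
    then have "c \<noteq> 0" by auto
    then obtain i where "i \<in> Poly_Mapping.keys c" using keys_eq_empty[of c] by (metis ex_in_conv)
    then have i: "i \<in> Poly_Mapping.keys c" "i \<in> {1..n}" using c(1) by (auto simp: exps_def)
    let ?e = "Poly_Mapping.single i (1::nat)"
    have eq: "c = (c - ?e) + ?e"
      using i by (intro poly_mapping_eqI) (auto simp: lookup_add lookup_minus lookup_single when_def in_keys_iff)
    have "Poly_Mapping.lookup ?e i \<noteq> Poly_Mapping.lookup 0 i" by simp
    then have "?e \<noteq> 0" by metis
    then have e: "?e \<in> exps n - {0}" using i by (auto simp: exps_def)
    have "Poly_Mapping.keys (c - ?e) \<subseteq> Poly_Mapping.keys c" by (auto simp: in_keys_iff lookup_minus)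
    then have ce: "c - ?e \<in> exps n" using c by (auto simp: exps_def)
    have "mdeg n ?e = 1" using i by (simp add: mdeg_def lookup_single when_def)
    then have "mdeg n c = mdeg n (c - ?e) + 1" using mdeg_add[of n "c - ?e" ?e] eq by simp
    then have "k \<le> mdeg n (c - ?e)" using c by simp
    then show "c \<in> mpow n (exps n - {0}) (Suc k)"
      unfolding mpow.simps Suc.IH msum_def using eq e ce by blast
  qed
qed auto

section \<open>The length of the zeroth local cohomology\<close>

text \<open>One vector from each gap \<open>W (Suc i) - W i\<close> gives an independent family:
  each lies outside the span of its predecessors, which is contained in \<open>W i\<close>.\<close>

lemma (in vector_space) subspace_chain_le:
  assumes "finite B" and sub: "\<And>i. i \<le> l \<Longrightarrow> subspace (W i)"
    and chain: "\<And>i. i < l \<Longrightarrow> W i \<subset> W (Suc i)" and B: "W l \<subseteq> span B"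
  shows "l \<le> card B"
proof -
  have mono: "W i \<subseteq> W j" if "i \<le> j" "j \<le> l" for i j
    using that
  proof (induction j rule: dec_induct)
    case (step k)
    then show ?case using chain[of k] by auto
  qed simp
  have "\<forall>i. \<exists>g. i < l \<longrightarrow> g \<in> W (Suc i) - W i" using chain by blast
  then obtain g where g: "\<And>i. i < l \<Longrightarrow> g i \<in> W (Suc i) - W i" by metis
  have img: "g ` {..<j} \<subseteq> W j" if "j \<le> l" for j
  proof
    fix x assume "x \<in> g ` {..<j}"
    then obtain i where "i < j" "x = g i" by blast
    then show "x \<in> W j" using g[of i] mono[of "Suc i" j] that by auto
  qed
  have "j \<le> l \<Longrightarrow> independent (g ` {..<j}) \<and> card (g ` {..<j}) = j" for j
  proof (induction j)
    case 0
    show ?case by (simp add: independent_empty)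
  next
    case (Suc j)
    have "span (g ` {..<j}) \<subseteq> W j"
      by (intro span_minimal img sub) (use Suc.prems in simp_all)
    then have notin: "g j \<notin> span (g ` {..<j})" using g[of j] Suc.prems by auto
    then have notin': "g j \<notin> g ` {..<j}" using span_base[of "g j" "g ` {..<j}"] by argo
    have "g ` {..<Suc j} = insert (g j) (g ` {..<j})" by (simp add: lessThan_Suc)
    then show ?case using Suc notin notin' by (simp add: independent_insert)
  qed
  then have *: "independent (g ` {..<l})" "card (g ` {..<l}) = l" by auto
  from img[of l] B have "g ` {..<l} \<subseteq> span B" by blast
  from independent_span_bound[OF \<open>finite B\<close> *(1) this] *(2) show ?thesis by simp
qed

lemma vector_space_polynomial:
  "vector_space (\<lambda>c (p::'k::field polynomial). Poly_Mapping.single 0 c * p)"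
  by unfold_locales (simp_all add: algebra_simps single_add mult_single flip: mult.assoc)

lemma polynomial_in_span:
  assumes "finite A" "Poly_Mapping.keys p \<subseteq> A"
  shows "(p::'k::field polynomial) \<in>
    module.span (\<lambda>c p. Poly_Mapping.single 0 c * p) ((\<lambda>a. Poly_Mapping.single a 1) ` A)"
proof -
  interpret vs: vector_space "\<lambda>c (p::'k polynomial). Poly_Mapping.single 0 c * p"
    by (rule vector_space_polynomial)
  have "(\<Sum>a\<in>A. Poly_Mapping.single 0 (Poly_Mapping.lookup p a) * Poly_Mapping.single a 1) \<in>
      vs.span ((\<lambda>a. Poly_Mapping.single a 1) ` A)"
    by (intro vs.span_sum vs.span_scale vs.span_base imageI)
  then show ?thesis using assms by (simp add: mult_single sum_single_keys)
qed

text \<open>Adding to \<open>S\<close> an element of \<open>T - S\<close> of maximal degree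
  preserves up-closedness: its proper multiples lie in \<open>T\<close> and have larger degree,
  hence already lie in \<open>S\<close>. In this way the missing monomials are inserted one by
  one.\<close>

lemma upset_chain:
  assumes "finite (T - S)" "upset n S" "upset n T" "S \<subseteq> T"
  shows "\<exists>U. (\<forall>i\<le>card (T - S). upset n (U i) \<and> S \<subseteq> U i \<and> U i \<subseteq> T) \<and>
    (\<forall>i<card (T - S). U i \<subset> U (Suc i))"
  using assms
proof (induction "card (T - S)" arbitrary: S)
  case 0
  then show ?case by (intro exI[of _ "\<lambda>_. S"]) auto
next
  case (Suc N)
  have "T - S \<noteq> {}" using Suc.hyps(2) by force
  then have "Max (mdeg n ` (T - S)) \<in> mdeg n ` (T - S)" using Suc.prems(1) by (intro Max_in) auto
  then obtain a where a: "a \<in> T" "a \<notin> S" "mdeg n a = Max (mdeg n ` (T - S))" by auto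
  have max: "mdeg n b \<le> mdeg n a" if "b \<in> T - S" for b
    unfolding a(3) using that Suc.prems(1) by (intro Max_ge) auto
  let ?S = "insert a S"
  have "a + b \<in> ?S" if b: "b \<in> exps n" for b
  proof (cases "b = 0")
    case False
    then have "mdeg n b \<noteq> 0" using b by (simp add: mdeg_eq_0_iff)
    then have "mdeg n (a + b) > mdeg n a" by (simp add: mdeg_add)
    then have "a + b \<notin> T - S" using max by force
    then show ?thesis using upsetD[OF Suc.prems(3) a(1) b] by blast
  qed simp
  then have up: "upset n ?S" using Suc.prems a unfolding upset_def by auto
  have "T - ?S = (T - S) - {a}" by blast
  moreover have "a \<in> T - S" using a by blast
  ultimately have card: "N = card (T - ?S)"
    using Suc.hyps(2) Suc.prems(1) by (simp only: card_Diff_singleton)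
  have "finite (T - ?S)" "?S \<subseteq> T" using Suc.prems a by auto
  from Suc.hyps(1)[OF card this(1) up Suc.prems(3) this(2)] obtain U
    where U: "\<forall>i\<le>N. upset n (U i) \<and> ?S \<subseteq> U i \<and> U i \<subseteq> T" "\<forall>i<N. U i \<subset> U (Suc i)"
    unfolding card[symmetric] by (elim exE conjE)
  show ?case
  proof (intro exI[of _ "\<lambda>i. case i of 0 \<Rightarrow> S | Suc j \<Rightarrow> U j"] conjI allI impI)
    fix i assume "i < card (T - S)"
    then show "(case i of 0 \<Rightarrow> S | Suc j \<Rightarrow> U j) \<subset> (case Suc i of 0 \<Rightarrow> S | Suc j \<Rightarrow> U j)"
      using U a Suc.hyps(2) by (cases i) auto
  qed (use U Suc in \<open>auto split: nat.splits\<close>)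
qed

section \<open>Saturation and annihilation by powers of the maximal ideal\<close>

definition saturation :: "nat \<Rightarrow> (nat \<Rightarrow>\<^sub>0 nat) set \<Rightarrow> (nat \<Rightarrow>\<^sub>0 nat) set" where
  "saturation n S = {a \<in> exps n. \<exists>k. \<forall>b\<in>exps n. k \<le> mdeg n b \<longrightarrow> a + b \<in> S}"

lemma subset_saturation: "upset n S \<Longrightarrow> S \<subseteq> saturation n S"
  by (auto simp: saturation_def upset_def)

lemma upset_saturation:
  assumes S: "upset n S"
  shows "upset n (saturation n S)"
  unfolding upset_def
proof (intro conjI ballI)
  fix a b assume "a \<in> saturation n S" "b \<in> exps n"
  then obtain k where a: "a \<in> exps n" and k: "\<And>b. b \<in> exps n \<Longrightarrow> k \<le> mdeg n b \<Longrightarrow> a + b \<in> S"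
    by (auto simp: saturation_def)
  have "a + b + c \<in> S" if "c \<in> exps n" "k \<le> mdeg n c" for c
    using upsetD[OF S k[OF that] \<open>b \<in> exps n\<close>] by (simp add: ac_simps)
  then show "a + b \<in> saturation n S"
    using a \<open>b \<in> exps n\<close> unfolding saturation_def by (blast intro: exps_add)
qed (auto simp: saturation_def)

text \<open>Multiplication by a monomial shifts the support of the numerator without cancellation,
  so annihilation is tested exponent by exponent. Conversely, the finitely many exponents of a
  numerator admit a common power of the maximal ideal.\<close>

lemma annihilated_iff:
  fixes x :: "'k::field polynomial fract"
  assumes S: "upset n S" and x: "x \<in> mono_ideal n (exps n)"
  shows "(\<exists>k. \<forall>m\<in>ideal_power (local_poly_ring n) (max_ideal (local_poly_ring n)) k. m * x \<in> mono_ideal n S)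
    \<longleftrightarrow> x \<in> mono_ideal n (saturation n S)"
proof -
  let ?D = "\<lambda>k. {a \<in> exps n. k \<le> mdeg n a}"
  have pow: "ideal_power (local_poly_ring n) (max_ideal (local_poly_ring n)) k =
      (mono_ideal n (?D k) :: 'k polynomial fract set)" for k
    by (simp add: max_ideal_local_poly_ring ideal_power_mono_ideal upset_nonzero mpow_nonzero)
  have upD: "upset n (?D k)" for k by (auto simp: upset_def exps_add mdeg_add)
  obtain p q where x': "x = Fract p q" and p: "p \<in> polys_in n" and q: "q \<in> polys_in n"
      "Poly_Mapping.lookup q 0 \<noteq> 0" "q \<noteq> 0"
    using x by (rule mono_idealE)
  show ?thesis
  proof
    assume "\<exists>k. \<forall>m\<in>ideal_power (local_poly_ring n) (max_ideal (local_poly_ring n)) k. m * x \<in> mono_ideal n S"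
    then obtain k where k: "\<And>m. m \<in> mono_ideal n (?D k) \<Longrightarrow> m * x \<in> mono_ideal n S"
      unfolding pow by blast
    have "a + b \<in> S" if a: "a \<in> Poly_Mapping.keys p" and b: "b \<in> exps n" "k \<le> mdeg n b" for a b
    proof -
      have "monom_fract b * x \<in> mono_ideal n S"
        using b by (intro k) (simp add: monom_fract_in_mono_ideal_iff upD)
      then have sub: "Poly_Mapping.keys (Poly_Mapping.single b 1 * p) \<subseteq> S"
        using p q b by (simp add: x' Fract_in_mono_ideal_iff[OF S] polys_in_times polys_in_single)
      have "Poly_Mapping.lookup (Poly_Mapping.single b 1 * p) (a + b) =
          (\<Sum>d\<in>Poly_Mapping.keys p. if d = a then Poly_Mapping.lookup p d else 0)"
        by (subst lookup_times_keys) (auto simp: add.commute[of b] intro!: sum.cong)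
      then have "a + b \<in> Poly_Mapping.keys (Poly_Mapping.single b 1 * p)"
        using a by (simp add: in_keys_iff)
      then show ?thesis using sub by blast
    qed
    then have "Poly_Mapping.keys p \<subseteq> saturation n S"
      using p unfolding saturation_def polys_in_exps by blast
    then show "x \<in> mono_ideal n (saturation n S)"
      unfolding x' by (intro mono_idealI upset_saturation S q)
  next
    assume "x \<in> mono_ideal n (saturation n S)"
    then have sat: "Poly_Mapping.keys p \<subseteq> saturation n S"
      using p q by (simp add: x' Fract_in_mono_ideal_iff[OF upset_saturation[OF S]])
    define K where "K a = (SOME k. \<forall>b\<in>exps n. k \<le> mdeg n b \<longrightarrow> a + b \<in> S)" for a
    have K: "a + b \<in> S" if "a \<in> Poly_Mapping.keys p" "b \<in> exps n" "K a \<le> mdeg n b" for a b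
    proof -
      have "\<exists>k. \<forall>b\<in>exps n. k \<le> mdeg n b \<longrightarrow> a + b \<in> S"
        using sat that(1) by (auto simp: saturation_def)
      then have "\<forall>b\<in>exps n. K a \<le> mdeg n b \<longrightarrow> a + b \<in> S" unfolding K_def by (rule someI_ex)
      then show ?thesis using that by blast
    qed
    define k where "k = (\<Sum>a\<in>Poly_Mapping.keys p. K a)"
    have Kk: "K a \<le> k" if "a \<in> Poly_Mapping.keys p" for a
      unfolding k_def using that by (intro member_le_sum) auto
    have x2: "x \<in> mono_ideal n (Poly_Mapping.keys p)"
      unfolding x' mono_ideal_def using p q by blast
    have "m * x \<in> mono_ideal n S" if "m \<in> mono_ideal n (?D k)" for m
    proof (rule mono_ideal_times[OF S _ that x2])
      fix b a assume "b \<in> ?D k" "a \<in> Poly_Mapping.keys p"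
      then show "b + a \<in> S" using K[of a b] Kk[of a] by (simp add: add.commute)
    qed
    then show "\<exists>k. \<forall>m\<in>ideal_power (local_poly_ring n) (max_ideal (local_poly_ring n)) k. m * x \<in> mono_ideal n S"
      unfolding pow by blast
  qed
qed

section \<open>Submodules of the local cohomology and its length\<close>

abbreviation local_coho :: "nat \<Rightarrow> 'k::field polynomial fract set \<Rightarrow> ('k polynomial fract, 'k polynomial fract set) module" where
  "local_coho n J \<equiv> local_cohomology0 (local_poly_ring n) (max_ideal (local_poly_ring n))
     (quot_module (local_poly_ring n) J)"

context
  fixes n :: nat and S :: "(nat \<Rightarrow>\<^sub>0 nat) set" and J :: "'k::field polynomial fract set"
    and R :: "'k polynomial fract ring"
  assumes S: "upset n S"
  defines "J \<equiv> mono_ideal n S" and "R \<equiv> local_poly_ring n"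
begin

lemma ideal_J: "ideal J R"
  unfolding J_def R_def by (rule ideal_mono_ideal[OF S])

lemma coset_eq_iff:
  assumes "x \<in> carrier R" "y \<in> carrier R"
  shows "J +>\<^bsub>R\<^esub> x = J +>\<^bsub>R\<^esub> y \<longleftrightarrow> x - y \<in> J"
proof -
  interpret ideal J R by (rule ideal_J)
  have "\<ominus>\<^bsub>R\<^esub> y = - y"
  proof (rule minus_equality)
    show "- y \<in> carrier R" "y \<in> carrier R"
      using assms mono_ideal_uminus[OF upset_exps_self]
      by (auto simp: R_def carrier_local_poly_ring)
  qed (simp add: R_def)
  then have "x \<ominus>\<^bsub>R\<^esub> y = x - y" by (simp add: a_minus_def R_def)
  then show ?thesis using quotient_eq_iff_same_a_r_cos[OF ideal_J assms] by simp
qed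

lemma coset_eq_J_iff: "x \<in> carrier R \<Longrightarrow> J +>\<^bsub>R\<^esub> x = J \<longleftrightarrow> x \<in> J"
proof -
  assume x: "x \<in> carrier R"
  interpret ideal J R by (rule ideal_J)
  have 0: "J +>\<^bsub>R\<^esub> 0 = J" using a_rcos_zero[OF ideal_J, of 0] zero_closed
    by (simp add: R_def J_def)
  have "0 \<in> carrier R" by (simp add: R_def carrier_local_poly_ring)
  from coset_eq_iff[OF x this] show ?thesis by (simp add: 0)
qed

lemma
  shows local_coho_add: "x \<in> carrier R \<Longrightarrow> y \<in> carrier R \<Longrightarrow>
      (J +>\<^bsub>R\<^esub> x) \<oplus>\<^bsub>local_coho n J\<^esub> (J +>\<^bsub>R\<^esub> y) = J +>\<^bsub>R\<^esub> (x + y)"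
    and local_coho_smult: "x \<in> carrier R \<Longrightarrow> y \<in> carrier R \<Longrightarrow>
      x \<odot>\<^bsub>local_coho n J\<^esub> (J +>\<^bsub>R\<^esub> y) = J +>\<^bsub>R\<^esub> (x * y)"
    and local_coho_zero: "\<zero>\<^bsub>local_coho n J\<^esub> = J"
    and local_coho_carrier: "carrier (local_coho n J) = (\<lambda>x. J +>\<^bsub>R\<^esub> x) ` mono_ideal n (saturation n S)"
proof -
  interpret ideal J R by (rule ideal_J)
  note defs = local_cohomology0_def quot_module_def FactRing_def R_def[symmetric]
  show "(J +>\<^bsub>R\<^esub> x) \<oplus>\<^bsub>local_coho n J\<^esub> (J +>\<^bsub>R\<^esub> y) = J +>\<^bsub>R\<^esub> (x + y)"
    if "x \<in> carrier R" "y \<in> carrier R"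
    using a_rcos_sum[OF that] by (simp add: defs) (simp add: R_def)
  show sm: "x \<odot>\<^bsub>local_coho n J\<^esub> (J +>\<^bsub>R\<^esub> y) = J +>\<^bsub>R\<^esub> (x * y)"
    if "x \<in> carrier R" "y \<in> carrier R" for x y
    using rcoset_mult_add[OF that] by (simp add: defs) (simp add: R_def)
  show "\<zero>\<^bsub>local_coho n J\<^esub> = J" by (simp add: defs)
  have R: "carrier R = mono_ideal n (exps n)" by (simp add: R_def carrier_local_poly_ring)
  have "carrier (local_coho n J) = {X \<in> (\<lambda>x. J +>\<^bsub>R\<^esub> x) ` carrier R.
     \<exists>k. \<forall>a\<in>ideal_power R (max_ideal R) k. a \<odot>\<^bsub>local_coho n J\<^esub> X = J}"
    by (auto simp: defs A_RCOSETS_def' image_def)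
  also have "\<dots> = (\<lambda>x. J +>\<^bsub>R\<^esub> x) ` mono_ideal n (saturation n S)"
  proof -
    have sub: "mono_ideal n (saturation n S) \<subseteq> carrier R"
      unfolding R by (intro mono_ideal_mono upset_exps upset_saturation S)
    have max: "ideal_power R (max_ideal R) k \<subseteq> carrier R" for k
      unfolding R unfolding R_def max_ideal_local_poly_ring
      by (simp add: ideal_power_mono_ideal upset_nonzero mono_ideal_mono upset_exps upset_mpow)
    have iff: "(\<exists>k. \<forall>a\<in>ideal_power R (max_ideal R) k. a \<odot>\<^bsub>local_coho n J\<^esub> (J +>\<^bsub>R\<^esub> x) = J) \<longleftrightarrow>
        x \<in> mono_ideal n (saturation n S)" if x: "x \<in> carrier R" for x
    proof -
      have "a \<odot>\<^bsub>local_coho n J\<^esub> (J +>\<^bsub>R\<^esub> x) = J \<longleftrightarrow> a * x \<in> J"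
        if "a \<in> ideal_power R (max_ideal R) k" for a k
      proof -
        have a: "a \<in> carrier R" using max that by blast
        then have "a * x \<in> carrier R" using m_closed[OF a x] by (simp add: R_def)
        then show ?thesis by (simp add: sm a x coset_eq_J_iff)
      qed
      then have "(\<exists>k. \<forall>a\<in>ideal_power R (max_ideal R) k. a \<odot>\<^bsub>local_coho n J\<^esub> (J +>\<^bsub>R\<^esub> x) = J) \<longleftrightarrow>
        (\<exists>k. \<forall>a\<in>ideal_power R (max_ideal R) k. a * x \<in> J)" by blast
      also have "\<dots> \<longleftrightarrow> x \<in> mono_ideal n (saturation n S)"
        unfolding R_def J_def by (rule annihilated_iff[OF S]) (use x R in simp)
      finally show ?thesis .
    qed
    show ?thesis
    proof (intro equalityI subsetI)
      fix X assume "X \<in> {X \<in> (\<lambda>x. J +>\<^bsub>R\<^esub> x) ` carrier R.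
        \<exists>k. \<forall>a\<in>ideal_power R (max_ideal R) k. a \<odot>\<^bsub>local_coho n J\<^esub> X = J}"
      then obtain x where x: "x \<in> carrier R" "X = J +>\<^bsub>R\<^esub> x"
        and ann: "\<exists>k. \<forall>a\<in>ideal_power R (max_ideal R) k. a \<odot>\<^bsub>local_coho n J\<^esub> X = J" by blast
      show "X \<in> (\<lambda>x. J +>\<^bsub>R\<^esub> x) ` mono_ideal n (saturation n S)"
        using ann iff[OF x(1)] unfolding x(2) by (intro imageI) simp
    next
      fix X assume "X \<in> (\<lambda>x. J +>\<^bsub>R\<^esub> x) ` mono_ideal n (saturation n S)"
      then obtain x where x: "x \<in> mono_ideal n (saturation n S)" "X = J +>\<^bsub>R\<^esub> x" by blast
      then have x': "x \<in> carrier R" using sub by blast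
      show "X \<in> {X \<in> (\<lambda>x. J +>\<^bsub>R\<^esub> x) ` carrier R.
        \<exists>k. \<forall>a\<in>ideal_power R (max_ideal R) k. a \<odot>\<^bsub>local_coho n J\<^esub> X = J}"
        using iff[OF x'] x(1) imageI[OF x', of "\<lambda>x. J +>\<^bsub>R\<^esub> x"] unfolding x(2) by simp
    qed
  qed
  finally show "carrier (local_coho n J) = (\<lambda>x. J +>\<^bsub>R\<^esub> x) ` mono_ideal n (saturation n S)" .
qed

text \<open>The additive inverse is a definite description over the restricted carrier, so the
  candidate must be shown to stay in the saturation and to be unique there; the subgroup property of
  submodules depends on it.\<close>

lemma local_coho_inv:
  assumes x: "x \<in> mono_ideal n (saturation n S)"
  shows "inv\<^bsub>add_monoid (local_coho n J)\<^esub> (J +>\<^bsub>R\<^esub> x) = J +>\<^bsub>R\<^esub> (- x)"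
  unfolding m_inv_def
proof (rule the_equality)
  have sub: "mono_ideal n (saturation n S) \<subseteq> carrier R"
    unfolding R_def carrier_local_poly_ring by (intro mono_ideal_mono upset_exps upset_saturation S)
  have nx: "- x \<in> mono_ideal n (saturation n S)"
    by (rule mono_ideal_uminus[OF upset_saturation[OF S] x])
  have J0: "J +>\<^bsub>R\<^esub> 0 = J"
    by (subst coset_eq_J_iff) (simp_all add: J_def R_def carrier_local_poly_ring)
  show "J +>\<^bsub>R\<^esub> (- x) \<in> carrier (add_monoid (local_coho n J)) \<and>
    (J +>\<^bsub>R\<^esub> x) \<otimes>\<^bsub>add_monoid (local_coho n J)\<^esub> (J +>\<^bsub>R\<^esub> (- x)) = \<one>\<^bsub>add_monoid (local_coho n J)\<^esub> \<and>
    (J +>\<^bsub>R\<^esub> (- x)) \<otimes>\<^bsub>add_monoid (local_coho n J)\<^esub> (J +>\<^bsub>R\<^esub> x) = \<one>\<^bsub>add_monoid (local_coho n J)\<^esub>"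
    using imageI[OF nx, of "\<lambda>x. J +>\<^bsub>R\<^esub> x"] subsetD[OF sub x] subsetD[OF sub nx]
    by (simp add: local_coho_carrier local_coho_zero local_coho_add J0)
  fix Y assume Y: "Y \<in> carrier (add_monoid (local_coho n J)) \<and>
    (J +>\<^bsub>R\<^esub> x) \<otimes>\<^bsub>add_monoid (local_coho n J)\<^esub> Y = \<one>\<^bsub>add_monoid (local_coho n J)\<^esub> \<and>
    Y \<otimes>\<^bsub>add_monoid (local_coho n J)\<^esub> (J +>\<^bsub>R\<^esub> x) = \<one>\<^bsub>add_monoid (local_coho n J)\<^esub>"
  then obtain y where y: "Y = J +>\<^bsub>R\<^esub> y" "y \<in> mono_ideal n (saturation n S)"
    by (auto simp: local_coho_carrier)
  then have "J +>\<^bsub>R\<^esub> (y + x) = J"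
    using Y x by (simp add: local_coho_zero local_coho_add subsetD[OF sub])
  moreover have "y + x \<in> carrier R"
    using mono_ideal_add[OF upset_saturation[OF S] y(2) x] sub by blast
  ultimately have "y + x \<in> J" by (simp add: coset_eq_J_iff)
  then show "Y = J +>\<^bsub>R\<^esub> (- x)"
    unfolding y using y(2) nx by (subst coset_eq_iff) (auto simp: subsetD[OF sub])
qed

text \<open>Supplies the submodules for the lower bound on the length, one for each set in a chain
  from \<open>S\<close> to its saturation.\<close>

lemma submodule_image_mono_ideal:
  assumes T: "upset n T" "S \<subseteq> T" "T \<subseteq> saturation n S"
  shows "submodule ((\<lambda>x. J +>\<^bsub>R\<^esub> x) ` mono_ideal n T) R (local_coho n J)"
proof -
  have sat: "mono_ideal n T \<subseteq> mono_ideal n (saturation n S)" using T by (intro mono_ideal_mono)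
  have sub: "mono_ideal n T \<subseteq> carrier R"
    unfolding R_def carrier_local_poly_ring by (intro mono_ideal_mono upset_exps T)
  show ?thesis
  proof (intro submodule.intro subgroup.intro submodule_axioms.intro)
    show "(\<lambda>x. J +>\<^bsub>R\<^esub> x) ` mono_ideal n T \<subseteq> carrier (add_monoid (local_coho n J))"
      using sat by (auto simp: local_coho_carrier)
    have "J +>\<^bsub>R\<^esub> 0 = J"
      by (subst coset_eq_J_iff) (simp_all add: J_def R_def carrier_local_poly_ring)
    then show "\<one>\<^bsub>add_monoid (local_coho n J)\<^esub> \<in> (\<lambda>x. J +>\<^bsub>R\<^esub> x) ` mono_ideal n T"
      by (auto simp: local_coho_zero intro!: image_eqI[of _ _ 0])
  next
    fix X Y assume "X \<in> (\<lambda>x. J +>\<^bsub>R\<^esub> x) ` mono_ideal n T" "Y \<in> (\<lambda>x. J +>\<^bsub>R\<^esub> x) ` mono_ideal n T"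
    then obtain x y where xy: "x \<in> mono_ideal n T" "y \<in> mono_ideal n T"
      "X = J +>\<^bsub>R\<^esub> x" "Y = J +>\<^bsub>R\<^esub> y" by blast
    have "X \<otimes>\<^bsub>add_monoid (local_coho n J)\<^esub> Y = J +>\<^bsub>R\<^esub> (x + y)"
      using subsetD[OF sub xy(1)] subsetD[OF sub xy(2)] by (simp add: xy local_coho_add)
    then show "X \<otimes>\<^bsub>add_monoid (local_coho n J)\<^esub> Y \<in> (\<lambda>x. J +>\<^bsub>R\<^esub> x) ` mono_ideal n T"
      using imageI[OF mono_ideal_add[OF T(1) xy(1,2)]] by simp
  next
    fix X assume "X \<in> (\<lambda>x. J +>\<^bsub>R\<^esub> x) ` mono_ideal n T"
    then obtain x where x: "x \<in> mono_ideal n T" "X = J +>\<^bsub>R\<^esub> x" by blast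
    then show "inv\<^bsub>add_monoid (local_coho n J)\<^esub> X \<in> (\<lambda>x. J +>\<^bsub>R\<^esub> x) ` mono_ideal n T"
      using local_coho_inv[OF subsetD[OF sat x(1)]] imageI[OF mono_ideal_uminus[OF T(1) x(1)]] by simp
  next
    fix x X assume x: "x \<in> carrier R" and "X \<in> (\<lambda>x. J +>\<^bsub>R\<^esub> x) ` mono_ideal n T"
    then obtain y where y: "X = J +>\<^bsub>R\<^esub> y" "y \<in> mono_ideal n T" by blast
    have "x * y \<in> mono_ideal n T"
      using ideal_times[OF ideal_mono_ideal[OF T(1)]] x y(2) by (simp add: R_def carrier_local_poly_ring)
    then show "x \<odot>\<^bsub>local_coho n J\<^esub> X \<in> (\<lambda>x. J +>\<^bsub>R\<^esub> x) ` mono_ideal n T"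
      using subsetD[OF sub y(2)] x by (simp add: y(1) local_coho_smult)
  qed
qed

text \<open>A submodule is recorded by the subspace \<open>W i\<close> of polynomials supported on
  \<open>saturation n S - S\<close> whose class it contains. Inclusions stay strict: the denominator
  of a new class is a unit and can be cleared, and the part of the numerator supported on
  \<open>S\<close> vanishes modulo \<open>J\<close>, so a polynomial supported on the difference
  represents a unit multiple of that class.\<close>

lemma submodule_chain_le:
  assumes fin: "finite (saturation n S - S)"
    and N: "\<And>i. i \<le> l \<Longrightarrow> submodule (N i) R (local_coho n J)"
    and chain: "\<And>i. i < l \<Longrightarrow> N i \<subset> N (Suc i)"
  shows "l \<le> card (saturation n S - S)"
proof -
  interpret vs: vector_space "\<lambda>c (p::'k polynomial). Poly_Mapping.single 0 c * p"
    by (rule vector_space_polynomial)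
  let ?A = "saturation n S - S"
  have sat: "saturation n S \<subseteq> exps n" by (intro upset_exps upset_saturation S)
  have car: "Fract p q \<in> carrier R" if "p \<in> polys_in n" "q \<in> polys_in n" "Poly_Mapping.lookup q 0 \<noteq> 0" for p q
    using that unfolding R_def carrier_local_poly_ring polys_in_exps
    by (intro mono_idealI upset_exps_self) (simp_all add: polys_in_exps)
  have carA: "Fract p 1 \<in> carrier R" if "Poly_Mapping.keys p \<subseteq> saturation n S" for p
    using that sat by (intro car) (auto simp: polys_in_exps)
  have add: "(J +>\<^bsub>R\<^esub> x) \<in> N i \<Longrightarrow> (J +>\<^bsub>R\<^esub> y) \<in> N i \<Longrightarrow> J +>\<^bsub>R\<^esub> (x + y) \<in> N i"
    if "i \<le> l" "x \<in> carrier R" "y \<in> carrier R" for i x y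
    using subgroup.m_closed[OF submodule.axioms(1)[OF N[OF that(1)]]]
      local_coho_add[OF that(2,3)] by (metis monoid.simps(1))
  have smult: "J +>\<^bsub>R\<^esub> x \<in> N i \<Longrightarrow> J +>\<^bsub>R\<^esub> (a * x) \<in> N i"
    if "i \<le> l" "a \<in> carrier R" "x \<in> carrier R" for i a x
    using submodule.smult_closed[OF N[OF that(1)] that(2)] local_coho_smult[OF that(2,3)] by metis
  have zero: "J +>\<^bsub>R\<^esub> 0 \<in> N i" if "i \<le> l" for i
  proof -
    have "J +>\<^bsub>R\<^esub> 0 = J"
      by (subst coset_eq_J_iff) (simp_all add: J_def R_def carrier_local_poly_ring)
    then show ?thesis using subgroup.one_closed[OF submodule.axioms(1)[OF N[OF that]]]
      by (simp add: local_coho_zero)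
  qed
  define W where "W i = {g. Poly_Mapping.keys g \<subseteq> ?A \<and> J +>\<^bsub>R\<^esub> (Fract g 1) \<in> N i}" for i
  have "l \<le> card ((\<lambda>a. Poly_Mapping.single a (1::'k)) ` ?A)"
  proof (rule vs.subspace_chain_le)
    fix i assume i: "i \<le> l"
    show "vs.subspace (W i)"
      unfolding vs.subspace_def
    proof (intro conjI ballI allI)
      show "0 \<in> W i" using zero[OF i] by (simp add: W_def fract_collapse)
      show "x + y \<in> W i" if "x \<in> W i" "y \<in> W i" for x y
        using that add[OF i carA[of x] carA[of y]] keys_plus_subset[of x ?A y] by (auto simp: W_def)
      fix c x assume x: "x \<in> W i"
      then have keys: "Poly_Mapping.keys x \<subseteq> ?A" by (simp add: W_def)
      have "Poly_Mapping.keys (Poly_Mapping.single 0 c * x) \<subseteq> ?A"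
        by (rule keys_times_subset) (use keys in \<open>auto split: if_splits\<close>)
      moreover have "J +>\<^bsub>R\<^esub> (Fract (Poly_Mapping.single 0 c) 1 * Fract x 1) \<in> N i"
        using x keys by (intro smult[OF i] carA car) (auto simp: W_def polys_in_single)
      ultimately show "Poly_Mapping.single 0 c * x \<in> W i" by (simp add: W_def)
    qed
  next
    fix i assume i: "i < l"
    then obtain X where X: "X \<in> N (Suc i)" "X \<notin> N i" using chain by blast
    have "N (Suc i) \<subseteq> carrier (local_coho n J)"
      using subgroup.subset[OF submodule.axioms(1)[OF N[of "Suc i"]]] i by simp
    then obtain x where x: "X = J +>\<^bsub>R\<^esub> x" "x \<in> mono_ideal n (saturation n S)"
      using X(1) by (auto simp: local_coho_carrier)
    obtain p q where x': "x = Fract p q" and q: "q \<in> polys_in n" "Poly_Mapping.lookup q 0 \<noteq> 0" "q \<noteq> 0"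
        and p: "p \<in> polys_in n" "Poly_Mapping.keys p \<subseteq> saturation n S"
      using x(2) by (rule mono_idealE)
    have "x \<in> carrier R" using x' p q car by simp
    have "Fract q 1 * x = Fract p 1" using q by (simp add: x' eq_fract)
    then have p1: "J +>\<^bsub>R\<^esub> Fract p 1 \<in> N (Suc i)"
      using smult[of "Suc i" "Fract q 1" x] i X(1) x(1) q car \<open>x \<in> carrier R\<close> by simp
    have "Fract 1 q * Fract p 1 = x" by (simp add: x')
    then have p2: "J +>\<^bsub>R\<^esub> Fract p 1 \<notin> N i"
      using smult[of i "Fract 1 q" "Fract p 1"] i X(2) x(1) p q car by auto
    let ?r = "restrict_keys (- S) p" and ?s = "restrict_keys S p"
    have p_eq: "p = ?s + ?r" by (rule restrict_keys_split)
    have keys: "Poly_Mapping.keys ?s \<subseteq> S" "Poly_Mapping.keys ?r \<subseteq> ?A"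
      using p by (auto simp: keys_restrict_keys)
    have "Fract p 1 - Fract ?r 1 = Fract ?s 1" by (subst p_eq) simp
    also have "\<dots> \<in> J" unfolding J_def by (intro mono_idealI S keys) auto
    finally have "J +>\<^bsub>R\<^esub> Fract p 1 = J +>\<^bsub>R\<^esub> Fract ?r 1"
      using p keys(2) by (subst coset_eq_iff) (auto intro!: carA)
    then have "?r \<in> W (Suc i)" "?r \<notin> W i" using p1 p2 keys(2) by (auto simp: W_def)
    moreover have "W i \<subseteq> W (Suc i)" using chain[OF i] by (auto simp: W_def)
    ultimately show "W i \<subset> W (Suc i)" by blast
  qed (use fin polynomial_in_span[OF fin] in \<open>auto simp: W_def\<close>)
  then show ?thesis using card_image_le[OF fin, of "\<lambda>a. Poly_Mapping.single a (1::'k)"] by simp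
qed

lemma module_length_local_coho:
  assumes fin: "finite (saturation n S - S)"
  shows "module_length R (local_coho n J) = enat (card (saturation n S - S))"
  unfolding module_length_def
proof (rule antisym)
  show "Sup {enat l |l. \<exists>N. (\<forall>i\<le>l. submodule (N i) R (local_coho n J)) \<and> (\<forall>i<l. N i \<subset> N (Suc i))}
    \<le> enat (card (saturation n S - S))"
    by (rule Sup_least) (use submodule_chain_le[OF fin] in force)
  obtain U where U: "\<And>i. i \<le> card (saturation n S - S) \<Longrightarrow> upset n (U i) \<and> S \<subseteq> U i \<and> U i \<subseteq> saturation n S"
    and strict: "\<And>i. i < card (saturation n S - S) \<Longrightarrow> U i \<subset> U (Suc i)"
    using upset_chain[OF fin S upset_saturation[OF S] subset_saturation[OF S]] by blast
  let ?N = "\<lambda>i. (\<lambda>x. J +>\<^bsub>R\<^esub> x) ` (mono_ideal n (U i) :: 'k polynomial fract set)"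
  have sub: "\<forall>i\<le>card (saturation n S - S). submodule (?N i) R (local_coho n J)"
    using U submodule_image_mono_ideal by blast
  have "?N i \<subset> ?N (Suc i)" if i: "i < card (saturation n S - S)" for i
  proof -
    have le: "?N i \<subseteq> ?N (Suc i)" using strict[OF i] by (intro image_mono mono_ideal_mono) auto
    obtain a where a: "a \<in> U (Suc i)" "a \<notin> U i" using strict[OF i] by blast
    have up: "upset n (U (Suc i))" "upset n (U i)" "S \<subseteq> U i" using U i by auto
    have aex: "a \<in> exps n" using upset_exps[OF up(1)] a by blast
    have in1: "monom_fract a \<in> (mono_ideal n (U (Suc i)) :: 'k polynomial fract set)"
      using a aex by (simp add: monom_fract_in_mono_ideal_iff[OF up(1)])
    \<comment> \<open>Since \<open>J\<close> is contained in the ideal of \<open>U i\<close>, an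
      equality of cosets would put the new monomial itself into that ideal.\<close>
    have "J +>\<^bsub>R\<^esub> monom_fract a \<notin> ?N i"
    proof
      assume "J +>\<^bsub>R\<^esub> monom_fract a \<in> ?N i"
      then obtain y where y: "y \<in> mono_ideal n (U i)" "J +>\<^bsub>R\<^esub> monom_fract a = J +>\<^bsub>R\<^esub> y" by blast
      have "monom_fract a - y \<in> J"
        using y(2) aex subsetD[OF mono_ideal_mono[OF upset_exps[OF up(2)]] y(1)]
        by (subst (asm) coset_eq_iff)
          (auto simp: R_def carrier_local_poly_ring monom_fract_in_mono_ideal_iff upset_exps_self)
      then have "monom_fract a - y \<in> mono_ideal n (U i)"
        unfolding J_def using mono_ideal_mono[OF up(3)] by blast
      from mono_ideal_add[OF up(2) this y(1)] show False
        using a aex by (simp add: monom_fract_in_mono_ideal_iff[OF up(2)])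
    qed
    then show ?thesis using le in1 by blast
  qed
  then have "\<exists>N. (\<forall>i\<le>card (saturation n S - S). submodule (N i) R (local_coho n J)) \<and>
    (\<forall>i<card (saturation n S - S). N i \<subset> N (Suc i))"
    using sub by (intro exI[of _ ?N]) blast
  then show "enat (card (saturation n S - S)) \<le>
    Sup {enat l |l. \<exists>N. (\<forall>i\<le>l. submodule (N i) R (local_coho n J)) \<and> (\<forall>i<l. N i \<subset> N (Suc i))}"
    by (intro Sup_upper) blast
qed

end

section \<open>The dimension of the local ring\<close>

text \<open>Dependence is needed for an indexed family, because distinct exponent tuples may give
  equal products; in that case the coefficients 1 and -1 already form a relation.\<close>

lemma (in vector_space) family_dependent:
  assumes A: "finite A" and B: "finite B" and f: "f ` A \<subseteq> span B" and card: "card B < card A"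
  shows "\<exists>c. (\<exists>a\<in>A. c a \<noteq> 0) \<and> (\<Sum>a\<in>A. scale (c a) (f a)) = 0"
proof (cases "inj_on f A")
  case True
  have "dependent (f ` A)"
  proof (rule ccontr)
    assume "\<not> dependent (f ` A)"
    from independent_span_bound[OF B this f] show False using card by (simp add: card_image True)
  qed
  then obtain u where u: "\<exists>v\<in>f ` A. u v \<noteq> 0" "(\<Sum>v\<in>f ` A. scale (u v) v) = 0"
    using A by (auto simp: dependent_finite)
  then show ?thesis by (intro exI[of _ "u \<circ> f"]) (auto simp: sum.reindex True)
next
  case False
  then obtain a b where ab: "a \<in> A" "b \<in> A" "a \<noteq> b" "f a = f b" by (auto simp: inj_on_def)
  let ?c = "\<lambda>x. if x = a then 1 else if x = b then - 1 else (0::'a)"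
  have "(\<Sum>x\<in>A. scale (?c x) (f x)) = (\<Sum>x\<in>{a, b}. scale (?c x) (f x))"
    using ab A by (intro sum.mono_neutral_right) auto
  also have "\<dots> = 0" using ab by simp
  finally have "(\<Sum>x\<in>A. scale (?c x) (f x)) = 0" .
  moreover have "\<exists>x\<in>A. ?c x \<noteq> 0" using ab by (intro bexI[of _ a]) auto
  ultimately show ?thesis by (intro exI[of _ ?c]) blast
qed

section \<open>Monomial counting and algebraic dependence\<close>

definition box :: "nat \<Rightarrow> nat \<Rightarrow> (nat \<Rightarrow>\<^sub>0 nat) set" where
  "box n d = {a \<in> exps n. \<forall>i. Poly_Mapping.lookup a i \<le> d}"

lemma finite_card_box: "finite (box n d) \<and> card (box n d) \<le> (d + 1) ^ n"
proof -
  let ?F = "{1..n} \<rightarrow>\<^sub>E {..d}"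
  let ?r = "\<lambda>a. restrict (Poly_Mapping.lookup a) {1..n}"
  have fin: "finite ?F" by (intro finite_PiE) auto
  have "inj_on ?r (box n d)"
  proof (rule inj_onI)
    fix a b assume ab: "a \<in> box n d" "b \<in> box n d" "?r a = ?r b"
    show "a = b"
    proof (rule poly_mapping_eqI)
      fix i
      show "Poly_Mapping.lookup a i = Poly_Mapping.lookup b i"
      proof (cases "i \<in> {1..n}")
        case True
        then show ?thesis using fun_cong[OF ab(3), of i] by simp
      next
        case False
        then have "i \<notin> Poly_Mapping.keys a" "i \<notin> Poly_Mapping.keys b"
          using ab(1,2) unfolding box_def exps_def by blast+
        then show ?thesis by (simp add: in_keys_iff)
      qed
    qed
  qed
  moreover have "?r ` box n d \<subseteq> ?F" by (auto simp: box_def)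
  ultimately have "finite (box n d)" "card (box n d) \<le> card ?F"
    using fin by (auto intro: inj_on_finite card_inj_on_le)
  then show ?thesis by (simp add: card_PiE)
qed

lemma box_add: "a \<in> box n d \<Longrightarrow> b \<in> box n e \<Longrightarrow> a + b \<in> box n (d + e)"
  by (auto simp: box_def exps_add lookup_add intro: add_mono)

lemma keys_power_box:
  fixes p :: "'k::field polynomial"
  assumes "Poly_Mapping.keys p \<subseteq> box n d"
  shows "Poly_Mapping.keys (p ^ k) \<subseteq> box n (k * d)"
proof (induction k)
  case (Suc k)
  show ?case
    unfolding power_Suc mult_Suc
    by (rule keys_times_subset) (use assms Suc in \<open>blast intro: box_add\<close>)
qed (simp add: box_def)

lemma keys_prod_box:
  fixes p :: "'i \<Rightarrow> 'k::field polynomial"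
  assumes "finite I" "\<And>i. i \<in> I \<Longrightarrow> Poly_Mapping.keys (p i) \<subseteq> box n d"
  shows "Poly_Mapping.keys (\<Prod>i\<in>I. p i) \<subseteq> box n (card I * d)"
  using assms
proof (induction I)
  case (insert i I)
  have "Poly_Mapping.keys (p i * (\<Prod>i\<in>I. p i)) \<subseteq> box n (d + card I * d)"
    by (rule keys_times_subset) (use insert in \<open>blast intro: box_add\<close>)
  then show ?case using insert by simp
qed (simp add: box_def)

lemma Fract_one_sum: "Fract (\<Sum>i\<in>I. f i) 1 = (\<Sum>i\<in>I. Fract (f i :: 'a::idom) 1)"
  by (induction I rule: infinite_finite_induct) (simp_all add: fract_collapse Fract_add_same)

lemma Fract_one_times: "Fract (a * b) 1 = Fract (a :: 'a::idom) 1 * Fract b 1"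
  by simp

lemma Fract_one_prod: "Fract (\<Prod>i\<in>I. f i) 1 = (\<Prod>i\<in>I. Fract (f i :: 'a::idom) 1)"
  by (induction I rule: infinite_finite_induct) (simp_all add: fract_collapse Fract_one_times del: mult_fract)

lemma Fract_one_power: "Fract (p ^ k) 1 = (Fract (p :: 'a::idom) 1) ^ k"
  by (induction k) (simp_all add: fract_collapse Fract_one_times del: mult_fract)

abbreviation const_fract :: "'k \<Rightarrow> 'k::field polynomial fract" where
  "const_fract c \<equiv> Fract (Poly_Mapping.single 0 c) 1"

text \<open>Comparing the \<open>N\<^sup>n\<^sup>+\<^sup>1\<close> products \<open>\<Prod>x\<^sub>i\<^bsup>\<alpha> i\<^esup>\<close>, \<open>\<alpha> i < N\<close>, with the \<open>O(N\<^sup>n)\<close>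
  monomials that can occur in them after clearing denominators.\<close>

lemma algebraic_dependence:
  fixes x :: "nat \<Rightarrow> 'k::field polynomial fract"
  assumes x: "\<And>i. i \<le> n \<Longrightarrow> x i \<in> mono_ideal n (exps n)"
  shows "\<exists>A c. finite A \<and> A \<noteq> {} \<and> A \<subseteq> extensional {..n} \<and> (\<forall>\<alpha>\<in>A. c \<alpha> \<noteq> 0) \<and>
    (\<Sum>\<alpha>\<in>A. const_fract (c \<alpha>) * (\<Prod>i\<in>{0..n}. x i ^ \<alpha> i)) = 0"
proof -
  have "\<forall>i. \<exists>p q. i \<le> n \<longrightarrow> x i = Fract p q \<and> p \<in> polys_in n \<and> q \<in> polys_in n \<and> q \<noteq> 0"
    using x by (metis mono_idealE)
  then obtain p q where pq: "\<And>i. i \<le> n \<Longrightarrow> x i = Fract (p i) (q i)"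
    "\<And>i. i \<le> n \<Longrightarrow> p i \<in> polys_in n" "\<And>i. i \<le> n \<Longrightarrow> q i \<in> polys_in n" "\<And>i. i \<le> n \<Longrightarrow> q i \<noteq> 0"
    by metis
  define U where "U = (\<Union>i\<le>n. Poly_Mapping.keys (p i) \<union> Poly_Mapping.keys (q i))"
  have U: "finite U" "U \<subseteq> exps n" using pq(2,3) by (auto simp: U_def polys_in_exps)
  define D where "D = (\<Sum>a\<in>U. mdeg n a)"
  have "U \<subseteq> box n D"
  proof
    fix a assume a: "a \<in> U"
    have "mdeg n a \<le> D" unfolding D_def using a U by (intro member_le_sum) auto
    moreover have "Poly_Mapping.lookup a i \<le> mdeg n a" for i
    proof (cases "i \<in> {1..n}")
      case True
      then show ?thesis unfolding mdeg_def by (intro member_le_sum) auto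
    next
      case False
      then have "i \<notin> Poly_Mapping.keys a" using a U unfolding exps_def by blast
      then show ?thesis by (simp add: in_keys_iff)
    qed
    ultimately show "a \<in> box n D" using a U by (auto simp: box_def intro: order_trans)
  qed
  then have box: "Poly_Mapping.keys (p i) \<subseteq> box n D" "Poly_Mapping.keys (q i) \<subseteq> box n D" if "i \<le> n" for i
    using that by (auto simp: U_def)
  \<comment> \<open>The cleared products have exponents bounded by \<open>d\<close>, and
    \<open>d + 1 \<le> N * C\<close>. The choice \<open>N = C ^ n + 1\<close> makes the at most
    \<open>(N * C) ^ n\<close> monomials fewer than the \<open>N ^ (n + 1)\<close> products.\<close>
  define C where "C = (n + 1) * D + 1"
  define N where "N = C ^ n + 1"
  define d where "d = (n + 1) * (N * D)"
  define A0 where "A0 = {..n} \<rightarrow>\<^sub>E {..<N}"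
  \<comment> \<open>The powers of \<open>q i\<close> bring all products to the common denominator
    formed by the \<open>q i ^ N\<close>, so a linear relation between these numerators is one
    between the products themselves.\<close>
  define f where "f \<alpha> = (\<Prod>i\<in>{0..n}. p i ^ \<alpha> i * q i ^ (N - \<alpha> i))" for \<alpha> :: "nat \<Rightarrow> nat"
  have finA0: "finite A0" unfolding A0_def by (intro finite_PiE) auto
  have cardA0: "card A0 = N ^ (n + 1)" unfolding A0_def by (simp add: card_PiE)
  have keys_f: "Poly_Mapping.keys (f \<alpha>) \<subseteq> box n d" if \<alpha>: "\<alpha> \<in> A0" for \<alpha>
  proof -
    have "Poly_Mapping.keys (p i ^ \<alpha> i * q i ^ (N - \<alpha> i)) \<subseteq> box n (N * D)" if i: "i \<le> n" for i
    proof -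
      have "\<alpha> i < N" using \<alpha> i by (auto simp: A0_def)
      then have "\<alpha> i * D + (N - \<alpha> i) * D = N * D" by (simp flip: add_mult_distrib)
      moreover have "Poly_Mapping.keys (p i ^ \<alpha> i * q i ^ (N - \<alpha> i)) \<subseteq> box n (\<alpha> i * D + (N - \<alpha> i) * D)"
        using keys_power_box[OF box(1)[OF i]] keys_power_box[OF box(2)[OF i]]
        by (intro keys_times_subset box_add) blast+
      ultimately show ?thesis by simp
    qed
    then have "Poly_Mapping.keys (f \<alpha>) \<subseteq> box n (card {0..n} * (N * D))"
      unfolding f_def by (intro keys_prod_box) auto
    then show ?thesis by (simp add: d_def)
  qed
  interpret vs: vector_space "\<lambda>c (p::'k polynomial). Poly_Mapping.single 0 c * p"
    by (rule vector_space_polynomial)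
  let ?B = "(\<lambda>a. Poly_Mapping.single a (1::'k)) ` box n d"
  have finB: "finite ?B" using finite_card_box by blast
  have "card ?B \<le> card (box n d)" using finite_card_box by (intro card_image_le) blast
  also have "\<dots> \<le> (d + 1) ^ n" using finite_card_box by blast
  also have "d + 1 \<le> N * C" by (simp add: d_def C_def N_def algebra_simps)
  then have "(d + 1) ^ n \<le> (N * C) ^ n" by (rule power_mono) simp
  also have "(N * C) ^ n = N ^ n * C ^ n" by (rule power_mult_distrib)
  also have "\<dots> < N ^ n * N" by (simp add: N_def)
  also have "\<dots> = card A0" by (simp add: cardA0)
  finally have "card ?B < card A0" .
  moreover have "f ` A0 \<subseteq> vs.span ?B"
    using keys_f finite_card_box by (auto intro!: polynomial_in_span)
  ultimately obtain c where c: "\<exists>a\<in>A0. c a \<noteq> 0" "(\<Sum>a\<in>A0. Poly_Mapping.single 0 (c a) * f a) = 0"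
    using vs.family_dependent[OF finA0 finB] by blast
  \<comment> \<open>Zero coefficients are dropped so that every exponent tuple that remains carries
    a unit.\<close>
  define A where "A = {\<alpha> \<in> A0. c \<alpha> \<noteq> 0}"
  define Q where "Q = (\<Prod>i\<in>{0..n}. Fract (q i) 1 ^ N)"
  have "Fract (q i) 1 \<noteq> 0" if "i \<le> n" for i
    using pq(4)[OF that] by (simp add: Zero_fract_def eq_fract)
  then have Q0: "Q \<noteq> 0" by (auto simp: Q_def)
  have clear: "(\<Prod>i\<in>{0..n}. x i ^ \<alpha> i) * Q = Fract (f \<alpha>) 1" if "\<alpha> \<in> A0" for \<alpha>
    unfolding Q_def f_def Fract_one_prod prod.distrib[symmetric]
  proof (rule prod.cong[OF refl])
    fix i assume i: "i \<in> {0..n}"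
    then have "\<alpha> i < N" using that by (auto simp: A0_def)
    then have "Fract (q i) 1 ^ N = Fract (q i) 1 ^ \<alpha> i * Fract (q i) 1 ^ (N - \<alpha> i)"
      by (simp flip: power_add)
    then have "x i ^ \<alpha> i * Fract (q i) 1 ^ N = (x i * Fract (q i) 1) ^ \<alpha> i * Fract (q i) 1 ^ (N - \<alpha> i)"
      by (simp add: power_mult_distrib)
    also have "x i * Fract (q i) 1 = Fract (p i) 1" using i pq(1,4) by (simp add: eq_fract)
    also have "Fract (p i) 1 ^ \<alpha> i * Fract (q i) 1 ^ (N - \<alpha> i) = Fract (p i ^ \<alpha> i * q i ^ (N - \<alpha> i)) 1"
      by (simp flip: Fract_one_power)
    finally show "x i ^ \<alpha> i * Fract (q i) 1 ^ N = Fract (p i ^ \<alpha> i * q i ^ (N - \<alpha> i)) 1" .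
  qed
  have "(\<Sum>\<alpha>\<in>A0. const_fract (c \<alpha>) * (\<Prod>i\<in>{0..n}. x i ^ \<alpha> i)) * Q =
      (\<Sum>\<alpha>\<in>A0. Fract (Poly_Mapping.single 0 (c \<alpha>) * f \<alpha>) 1)"
    unfolding sum_distrib_right by (intro sum.cong refl) (simp add: mult.assoc clear)
  also have "\<dots> = 0" unfolding Fract_one_sum[symmetric] c(2) by (simp add: fract_collapse)
  finally have "(\<Sum>\<alpha>\<in>A0. const_fract (c \<alpha>) * (\<Prod>i\<in>{0..n}. x i ^ \<alpha> i)) = 0" using Q0 by simp
  also have "(\<Sum>\<alpha>\<in>A0. const_fract (c \<alpha>) * (\<Prod>i\<in>{0..n}. x i ^ \<alpha> i)) =
      (\<Sum>\<alpha>\<in>A. const_fract (c \<alpha>) * (\<Prod>i\<in>{0..n}. x i ^ \<alpha> i))"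
    using finA0 by (intro sum.mono_neutral_right) (auto simp: A_def fract_collapse)
  finally have "(\<Sum>\<alpha>\<in>A. const_fract (c \<alpha>) * (\<Prod>i\<in>{0..n}. x i ^ \<alpha> i)) = 0" .
  moreover have "finite A" using finA0 by (simp add: A_def)
  moreover have "A \<noteq> {}" "A \<subseteq> extensional {..n}" "\<forall>\<alpha>\<in>A. c \<alpha> \<noteq> 0"
    using c(1) by (auto simp: A_def A0_def PiE_def)
  ultimately show ?thesis by blast
qed

section \<open>An upper bound for chains of primes\<close>

lemma ideal_sum:
  fixes I :: "'k::field polynomial fract set"
  assumes "ideal I (local_poly_ring n)" "\<And>a. a \<in> A \<Longrightarrow> f a \<in> I"
  shows "(\<Sum>a\<in>A. f a) \<in> I"
  using assms(2)
  by (induction A rule: infinite_finite_induct) (simp_all add: ideal_zero[OF assms(1)] ideal_plus[OF assms(1)])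

lemma local_ring_times: "x \<in> mono_ideal n (exps n) \<Longrightarrow> y \<in> mono_ideal n (exps n) \<Longrightarrow>
    x * y \<in> (mono_ideal n (exps n) :: 'k::field polynomial fract set)"
  by (rule ideal_times[OF ideal_mono_ideal[OF upset_exps_self]])

lemma local_ring_power: "x \<in> mono_ideal n (exps n) \<Longrightarrow>
    x ^ k \<in> (mono_ideal n (exps n) :: 'k::field polynomial fract set)"
  by (induction k) (simp_all add: local_ring_times)

lemma local_ring_prod: "(\<And>i. i \<in> I \<Longrightarrow> f i \<in> mono_ideal n (exps n)) \<Longrightarrow>
    (\<Prod>i\<in>I. f i) \<in> (mono_ideal n (exps n) :: 'k::field polynomial fract set)"
  by (induction I rule: infinite_finite_induct) (simp_all add: local_ring_times)

lemma const_fract_local_ring: "const_fract c \<in> (mono_ideal n (exps n) :: 'k::field polynomial fract set)"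
  by (intro mono_idealI upset_exps_self) simp_all

lemma prime_times:
  fixes P :: "'k::field polynomial fract set"
  assumes "primeideal P (local_poly_ring n)" "x \<in> mono_ideal n (exps n)" "y \<in> mono_ideal n (exps n)"
    "x * y \<in> P"
  shows "x \<in> P \<or> y \<in> P"
  using primeideal.I_prime[OF assms(1), of x y] assms(2-) by (simp add: carrier_local_poly_ring)

lemma prime_power_times:
  fixes P :: "'k::field polynomial fract set"
  assumes P: "primeideal P (local_poly_ring n)" and x: "x \<in> mono_ideal n (exps n)" "x \<notin> P"
    and y: "y \<in> mono_ideal n (exps n)" and xy: "x ^ k * y \<in> P"
  shows "y \<in> P"
  using xy
proof (induction k)
  case (Suc k)
  then have "x * (x ^ k * y) \<in> P" by (simp add: mult.assoc)
  then have "x ^ k * y \<in> P"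
    using prime_times[OF P x(1)] x y local_ring_times[OF local_ring_power[OF x(1)] y] by blast
  then show ?case by (rule Suc.IH)
qed simp

text \<open>From an algebraic relation between elements \<open>x\<^sub>i \<in> P\<^sub>i\<^sub>+\<^sub>1 - P\<^sub>i\<close>, one obtains a
  nonzero constant in \<open>P\<^sub>n\<^sub>+\<^sub>1\<close>: for \<open>i = 0, 1, \<dots>\<close> cancel the largest power of \<open>x\<^sub>i\<close> modulo
  \<open>P\<^sub>i\<close>, then discard the terms still divisible by \<open>x\<^sub>i\<close> modulo \<open>P\<^sub>i\<^sub>+\<^sub>1\<close>.\<close>

lemma prime_chain_le:
  fixes P :: "nat \<Rightarrow> 'k::field polynomial fract set"
  assumes prime: "\<And>i. i \<le> l \<Longrightarrow> primeideal (P i) (local_poly_ring n)"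
    and chain: "\<And>i. i < l \<Longrightarrow> P i \<subset> P (Suc i)"
  shows "l \<le> n"
proof (rule ccontr)
  assume "\<not> l \<le> n"
  then have l: "n < l" by simp
  let ?R = "mono_ideal n (exps n) :: 'k polynomial fract set"
  have "\<forall>i. \<exists>x. i \<le> n \<longrightarrow> x \<in> P (Suc i) - P i" using chain l by (meson le_less_trans psubset_imp_ex_mem)
  then obtain x where x: "\<And>i. i \<le> n \<Longrightarrow> x i \<in> P (Suc i) - P i" by metis
  have ideal: "ideal (P i) (local_poly_ring n)" if "i \<le> n + 1" for i
    using prime[of i] that l by (simp add: primeideal_def)
  have xR: "x i \<in> ?R" if "i \<le> n" for i using x[OF that] ideal_subset[OF ideal, of "Suc i"] that by auto
  obtain A c where A: "finite A" "A \<noteq> {}" "A \<subseteq> extensional {..n}" "\<And>\<alpha>. \<alpha> \<in> A \<Longrightarrow> c \<alpha> \<noteq> 0"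
    and rel: "(\<Sum>\<alpha>\<in>A. const_fract (c \<alpha>) * (\<Prod>i\<in>{0..n}. x i ^ \<alpha> i)) = 0"
    using algebraic_dependence[of n x, OF xR] by blast
  have "i \<le> n + 1 \<Longrightarrow> \<exists>B\<subseteq>A. B \<noteq> {} \<and> (\<forall>\<alpha>\<in>B. \<forall>\<beta>\<in>B. \<forall>j<i. \<alpha> j = \<beta> j) \<and>
      (\<Sum>\<alpha>\<in>B. const_fract (c \<alpha>) * (\<Prod>j\<in>{i..n}. x j ^ \<alpha> j)) \<in> P i" for i
  proof (induction i)
    case 0
    show ?case using A rel ideal_zero[OF ideal[of 0]] by (intro exI[of _ A]) simp
  next
    case (Suc i)
    then have i: "i \<le> n" by simp
    from Suc.IH Suc.prems obtain B where B: "B \<subseteq> A" "B \<noteq> {}" "\<forall>\<alpha>\<in>B. \<forall>\<beta>\<in>B. \<forall>j<i. \<alpha> j = \<beta> j"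
      and sumB: "(\<Sum>\<alpha>\<in>B. const_fract (c \<alpha>) * (\<Prod>j\<in>{i..n}. x j ^ \<alpha> j)) \<in> P i"
      by (meson Suc_leD)
    have finB: "finite B" using B(1) A(1) finite_subset by blast
    define m where "m = Min ((\<lambda>\<alpha>. \<alpha> i) ` B)"
    have m_le: "m \<le> \<alpha> i" if "\<alpha> \<in> B" for \<alpha> unfolding m_def using that finB by (intro Min_le) auto
    have m_in: "m \<in> (\<lambda>\<alpha>. \<alpha> i) ` B" unfolding m_def using finB B(2) by (intro Min_in) auto
    define B' where "B' = {\<alpha> \<in> B. \<alpha> i = m}"
    define g where "g \<alpha> = const_fract (c \<alpha>) * (\<Prod>j\<in>{Suc i..n}. x j ^ \<alpha> j)" for \<alpha>
    have gR: "g \<alpha> \<in> ?R" for \<alpha>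
      unfolding g_def by (intro local_ring_times const_fract_local_ring local_ring_prod local_ring_power xR) simp
    define Y where "Y = (\<Sum>\<alpha>\<in>B. x i ^ (\<alpha> i - m) * g \<alpha>)"
    have YR: "Y \<in> ?R"
      unfolding Y_def
      by (intro ideal_sum[OF ideal_mono_ideal[OF upset_exps_self]] local_ring_times local_ring_power xR i gR)
    have "const_fract (c \<alpha>) * (\<Prod>j\<in>{i..n}. x j ^ \<alpha> j) = x i ^ m * (x i ^ (\<alpha> i - m) * g \<alpha>)"
      if "\<alpha> \<in> B" for \<alpha>
    proof -
      have "(\<Prod>j\<in>{i..n}. x j ^ \<alpha> j) = x i ^ \<alpha> i * (\<Prod>j\<in>{Suc i..n}. x j ^ \<alpha> j)"
        using i by (simp add: prod.atLeast_Suc_atMost)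
      moreover have "x i ^ \<alpha> i = x i ^ m * x i ^ (\<alpha> i - m)"
        using m_le[OF that] by (simp flip: power_add)
      ultimately show ?thesis by (simp add: g_def ac_simps)
    qed
    then have "x i ^ m * Y \<in> P i" using sumB by (simp add: Y_def sum_distrib_left)
    then have "Y \<in> P i" using prime_power_times[OF prime xR[OF i] _ YR, of i m] x[OF i] i l by simp
    then have Y: "Y \<in> P (Suc i)" using chain[of i] i l by auto
    have idl: "ideal (P (Suc i)) (local_poly_ring n)" using ideal[of "Suc i"] i by simp
    have "(\<Sum>\<alpha>\<in>B - B'. x i ^ (\<alpha> i - m) * g \<alpha>) \<in> P (Suc i)"
    proof (rule ideal_sum[OF idl])
      fix \<alpha> assume "\<alpha> \<in> B - B'"
      then have "m < \<alpha> i" using m_le[of \<alpha>] by (auto simp: B'_def)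
      then have "x i ^ (\<alpha> i - m) = x i ^ (\<alpha> i - m - 1) * x i" 
        using power_minus_mult[of "\<alpha> i - m" "x i"] by simp
      then have eq: "x i ^ (\<alpha> i - m) * g \<alpha> = (x i ^ (\<alpha> i - m - 1) * g \<alpha>) * x i" by simp
      show "x i ^ (\<alpha> i - m) * g \<alpha> \<in> P (Suc i)"
        unfolding eq using x[OF i] i
        by (intro ideal_times[OF idl] local_ring_times local_ring_power xR gR) auto
    qed
    from ideal_plus[OF idl Y ideal_uminus[OF idl this]]
    have "Y - (\<Sum>\<alpha>\<in>B - B'. x i ^ (\<alpha> i - m) * g \<alpha>) \<in> P (Suc i)" by simp
    also have "Y - (\<Sum>\<alpha>\<in>B - B'. x i ^ (\<alpha> i - m) * g \<alpha>) = (\<Sum>\<alpha>\<in>B'. x i ^ (\<alpha> i - m) * g \<alpha>)"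
      unfolding Y_def using finB by (subst sum_diff) (auto simp: B'_def)
    also have "\<dots> = (\<Sum>\<alpha>\<in>B'. g \<alpha>)" by (intro sum.cong) (auto simp: B'_def)
    finally have sumB': "(\<Sum>\<alpha>\<in>B'. g \<alpha>) \<in> P (Suc i)" .
    have "B' \<subseteq> A" "B' \<noteq> {}" using B(1) m_in by (auto simp: B'_def)
    moreover have "\<alpha> j = \<beta> j" if "\<alpha> \<in> B'" "\<beta> \<in> B'" "j < Suc i" for \<alpha> \<beta> j
    proof (cases "j = i")
      case False
      then show ?thesis using B(3) that by (simp add: B'_def)
    qed (use that in \<open>simp add: B'_def\<close>)
    ultimately show ?case using sumB' unfolding g_def by blast
  qed
  from this[OF order_refl] obtain B where B: "B \<subseteq> A" "B \<noteq> {}"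
      "\<forall>\<alpha>\<in>B. \<forall>\<beta>\<in>B. \<forall>j<n + 1. \<alpha> j = \<beta> j"
    and "(\<Sum>\<alpha>\<in>B. const_fract (c \<alpha>) * (\<Prod>j\<in>{n + 1..n}. x j ^ \<alpha> j)) \<in> P (n + 1)" by blast
  then have sumB: "(\<Sum>\<alpha>\<in>B. const_fract (c \<alpha>)) \<in> P (n + 1)" by simp
  obtain \<alpha> where \<alpha>: "\<alpha> \<in> B" using B(2) by blast
  \<comment> \<open>After \<open>n + 1\<close> rounds the surviving tuples agree on
    \<open>{..n}\<close>; being extensional there they coincide, so a single nonzero coefficient is
    left and nothing can cancel it.\<close>
  have "\<beta> = \<alpha>" if "\<beta> \<in> B" for \<beta>
    using that \<alpha> B A(3) by (intro extensionalityI[of _ "{..n}"]) auto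
  then have "B = {\<alpha>}" using \<alpha> by blast
  then have c: "const_fract (c \<alpha>) \<in> P (n + 1)" using sumB by simp
  have "const_fract (inverse (c \<alpha>)) * const_fract (c \<alpha>) \<in> P (n + 1)"
    by (rule ideal_times[OF ideal const_fract_local_ring c]) simp
  moreover have "const_fract (inverse (c \<alpha>)) * const_fract (c \<alpha>) = 1"
    using A(4)[of \<alpha>] \<alpha> B(1) by (auto simp: mult_single One_fract_def)
  ultimately have "P (n + 1) = ?R" using ideal_one[OF ideal, of "n + 1"] by simp
  moreover have "P (n + 1) \<noteq> ?R"
    using primeideal.I_notcarr[OF prime[of "n + 1"]] l by (simp add: carrier_local_poly_ring)
  ultimately show False by blast
qed

text \<open>Split both numerators into their parts on and off \<open>T\<close>. The product of the
  two off-parts has its support inside \<open>T\<close>, because the whole product and all other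
  partial products do, and outside \<open>T\<close>, because the complement is closed under
  addition. So it is zero, and one off-part vanishes since polynomials form a domain.\<close>

lemma primeideal_mono_ideal:
  assumes T: "upset n T" and ne: "0 \<notin> T"
    and prime: "\<And>a b. a \<in> exps n \<Longrightarrow> b \<in> exps n \<Longrightarrow> a + b \<in> T \<Longrightarrow> a \<in> T \<or> b \<in> T"
  shows "primeideal (mono_ideal n T :: 'k::field polynomial fract set) (local_poly_ring n)"
proof (rule primeidealI[OF ideal_mono_ideal[OF T] cring_local_poly_ring])
  have "1 \<notin> (mono_ideal n T :: 'k polynomial fract set)"
    unfolding One_fract_def using ne by (subst Fract_in_mono_ideal_iff[OF T]) auto
  then show "carrier (local_poly_ring n) \<noteq> (mono_ideal n T :: 'k polynomial fract set)"
    unfolding carrier_local_poly_ring using one_in_mono_ideal_exps by blast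
  fix x y :: "'k polynomial fract"
  assume xy: "x \<in> carrier (local_poly_ring n)" "y \<in> carrier (local_poly_ring n)"
    "x \<otimes>\<^bsub>local_poly_ring n\<^esub> y \<in> mono_ideal n T"
  obtain p q where x: "x = Fract p q" "p \<in> polys_in n" "q \<in> polys_in n"
    "Poly_Mapping.lookup q 0 \<noteq> 0" using xy(1) unfolding carrier_local_poly_ring by (rule mono_idealE)
  obtain r s where y: "y = Fract r s" "r \<in> polys_in n" "s \<in> polys_in n"
    "Poly_Mapping.lookup s 0 \<noteq> 0" using xy(2) unfolding carrier_local_poly_ring by (rule mono_idealE)
  have pr: "Poly_Mapping.keys (p * r) \<subseteq> T"
    using xy(3) x y by (simp add: Fract_in_mono_ideal_iff[OF T] polys_in_times lookup_times_0)
  let ?p0 = "restrict_keys T p" and ?p1 = "restrict_keys (- T) p"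
  let ?r0 = "restrict_keys T r" and ?r1 = "restrict_keys (- T) r"
  have "p * r = (?p0 + ?p1) * (?r0 + ?r1)" using restrict_keys_split by metis
  then have eq: "?p1 * ?r1 = p * r - (?p0 * (?r0 + ?r1) + ?p1 * ?r0)" by (simp add: algebra_simps)
  have "Poly_Mapping.keys (?r0 + ?r1) \<subseteq> exps n"
    using y(2) restrict_keys_split[of r T] by (simp add: polys_in_exps)
  then have "Poly_Mapping.keys (?p0 * (?r0 + ?r1)) \<subseteq> T"
    using upsetD[OF T] by (intro keys_times_subset) (auto simp: keys_restrict_keys)
  moreover have "Poly_Mapping.keys (?p1 * ?r0) \<subseteq> T"
    using x(2) upsetD[OF T] unfolding polys_in_exps
    by (intro keys_times_subset) (subst add.commute, auto simp: keys_restrict_keys)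
  ultimately have "Poly_Mapping.keys (?p1 * ?r1) \<subseteq> T"
    unfolding eq using pr by (intro keys_minus_subset keys_plus_subset)
  moreover have "Poly_Mapping.keys (?p1 * ?r1) \<subseteq> - T"
    using x(2) y(2) prime unfolding polys_in_exps
    by (intro keys_times_subset) (auto simp: keys_restrict_keys)
  ultimately have "?p1 * ?r1 = 0" using keys_eq_empty[of "?p1 * ?r1"] by blast
  then have "?p1 = 0 \<or> ?r1 = 0" by simp
  then have "Poly_Mapping.keys p \<subseteq> T \<or> Poly_Mapping.keys r \<subseteq> T"
    using keys_restrict_keys[of "- T" p] keys_restrict_keys[of "- T" r] by auto
  then show "x \<in> mono_ideal n T \<or> y \<in> mono_ideal n T"
    using x y by (simp add: Fract_in_mono_ideal_iff[OF T])
qed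

lemma krull_dim_local_poly_ring:
  "krull_dim (local_poly_ring n :: 'k::field polynomial fract ring) = enat n"
  unfolding krull_dim_def
proof (rule antisym)
  let ?R = "local_poly_ring n :: 'k polynomial fract ring"
  show "Sup {enat l |l. \<exists>P. (\<forall>i\<le>l. primeideal (P i) ?R) \<and> (\<forall>i<l. P i \<subset> P (Suc i))} \<le> enat n"
  proof (rule Sup_least, elim CollectE exE conjE)
    fix e l and P :: "nat \<Rightarrow> 'k polynomial fract set"
    assume "e = enat l" "\<forall>i\<le>l. primeideal (P i) ?R" "\<forall>i<l. P i \<subset> P (Suc i)"
    then show "e \<le> enat n" using prime_chain_le[of l P n] by simp
  qed
  \<comment> \<open>These are the ideals generated by the first \<open>i\<close> variables;
    \<open>T 0\<close> is empty and gives the zero ideal, so the chain has \<open>n\<close> strict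
    steps.\<close>
  define T where "T i = {a \<in> exps n. \<exists>j\<in>{1..i}. Poly_Mapping.lookup a j \<noteq> 0}" for i
  have upT: "upset n (T i)" for i
    unfolding upset_def T_def by (auto simp: exps_add lookup_add)
  have "\<forall>i\<le>n. primeideal (mono_ideal n (T i)) ?R"
    using upT by (auto intro!: primeideal_mono_ideal simp: T_def lookup_add)
  moreover have "mono_ideal n (T i) \<subset> (mono_ideal n (T (Suc i)) :: 'k polynomial fract set)" if "i < n" for i
  proof -
    have le: "mono_ideal n (T i) \<subseteq> (mono_ideal n (T (Suc i)) :: 'k polynomial fract set)"
      by (intro mono_ideal_mono) (auto simp: T_def)
    let ?e = "Poly_Mapping.single (Suc i) (1::nat)"
    have e: "?e \<in> exps n" using that by (auto simp: exps_def)
    have "?e \<in> T (Suc i)" "?e \<notin> T i"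
      using e by (auto simp: T_def lookup_single when_def)
    then have "monom_fract ?e \<in> (mono_ideal n (T (Suc i)) :: 'k polynomial fract set)"
      "monom_fract ?e \<notin> (mono_ideal n (T i) :: 'k polynomial fract set)"
      using e upT by (simp_all add: monom_fract_in_mono_ideal_iff)
    then show ?thesis using le by blast
  qed
  ultimately have "\<exists>P. (\<forall>i\<le>n. primeideal (P i) ?R) \<and> (\<forall>i<n. P i \<subset> P (Suc i))"
    by (intro exI[of _ "\<lambda>i. mono_ideal n (T i)"]) blast
  then show "enat n \<le> Sup {enat l |l. \<exists>P. (\<forall>i\<le>l. primeideal (P i) ?R) \<and> (\<forall>i<l. P i \<subset> P (Suc i))}"
    by (intro Sup_upper) blast
qed

section \<open>Packing edges into a vertex-weighted cycle\<close>

definition prv :: "nat \<Rightarrow> nat \<Rightarrow> nat" where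
  "prv n p = (if p = 1 then n else p - 1)"

text \<open>Edge multiplicities \<open>z\<close>, where \<open>z p\<close> counts the edge from \<open>p\<close> to its successor.\<close>

definition fits :: "nat \<Rightarrow> (nat \<Rightarrow> nat) \<Rightarrow> nat \<Rightarrow> bool" where
  "fits n v t \<longleftrightarrow> (\<exists>z. t \<le> (\<Sum>p\<in>{1..n}. z p) \<and> (\<forall>p\<in>{1..n}. z p + z (prv n p) \<le> v p))"

definition cyc_cover :: "nat \<Rightarrow> nat set \<Rightarrow> bool" where
  "cyc_cover n C \<longleftrightarrow> C \<subseteq> {1..n} \<and> (\<forall>p\<in>{1..n}. p \<in> C \<or> prv n p \<in> C)"

definition path_cover :: "nat \<Rightarrow> nat set \<Rightarrow> bool" where
  "path_cover n C \<longleftrightarrow> C \<subseteq> {1..n} \<and> (\<forall>p\<in>{1..<n}. p \<in> C \<or> Suc p \<in> C)"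

lemma bij_prv: "bij_betw (prv n) {1..n} {1..n}"
proof (rule bij_betw_byWitness[where f' = "\<lambda>p. if p = n then 1 else p + 1"])
qed (auto simp: prv_def)

lemma sum_prv: "(\<Sum>p\<in>{1..n}. f (prv n p)) = (\<Sum>p\<in>{1..n}. f p)"
  by (rule sum.reindex_bij_betw[OF bij_prv])

lemma sum_add_prv:
  "(\<Sum>p\<in>{1..n}. z p + z (prv n p)) = 2 * (\<Sum>p\<in>{1..n}. z p :: 'a::comm_semiring_1)"
  by (simp only: sum.distrib sum_prv mult_2)

text \<open>Every edge has an end in the cover: the edge indexed by \<open>e\<close> is counted at
  the vertex \<open>e\<close> or at its successor, whose predecessor is \<open>e\<close>.\<close>

lemma cyc_cover_le_sum:
  fixes z :: "nat \<Rightarrow> nat"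
  assumes C: "cyc_cover n C"
  shows "(\<Sum>p\<in>{1..n}. z p) \<le> (\<Sum>p\<in>C. z p + z (prv n p))"
proof -
  have sub: "C \<subseteq> {1..n}" using C by (simp add: cyc_cover_def)
  then have fin: "finite C" by (rule finite_subset) simp
  have inj: "inj_on (prv n) C" using bij_prv sub by (meson bij_betw_imp_inj_on inj_on_subset)
  have "{1..n} \<subseteq> C \<union> prv n ` C"
  proof
    fix e assume "e \<in> {1..n}"
    then obtain p where "p \<in> {1..n}" "e = prv n p" using bij_prv[of n] by (metis bij_betw_def imageE)
    then show "e \<in> C \<union> prv n ` C" using C by (auto simp: cyc_cover_def)
  qed
  then have "(\<Sum>p\<in>{1..n}. z p) \<le> sum z (C \<union> prv n ` C)" using fin by (intro sum_mono2) auto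
  also have "\<dots> \<le> sum z C + sum z (prv n ` C)" using fin by (simp add: sum_Un_nat)
  also have "\<dots> = (\<Sum>p\<in>C. z p + z (prv n p))" by (simp add: sum.reindex[OF inj] sum.distrib)
  finally show ?thesis .
qed

lemma fits_cover:
  assumes "fits n v t" and C: "cyc_cover n C"
  shows "t \<le> sum v C"
proof -
  obtain z where z: "t \<le> (\<Sum>p\<in>{1..n}. z p)" "\<forall>p\<in>{1..n}. z p + z (prv n p) \<le> v p"
    using assms by (auto simp: fits_def)
  note z(1)
  also note cyc_cover_le_sum[OF C, of z]
  also have "(\<Sum>p\<in>C. z p + z (prv n p)) \<le> sum v C"
    using z(2) C by (intro sum_mono) (auto simp: cyc_cover_def)
  finally show ?thesis .
qed

lemma fits_degree:
  assumes "fits n v t"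
  shows "2 * t \<le> sum v {1..n}"
proof -
  obtain z where z: "t \<le> (\<Sum>p\<in>{1..n}. z p)" "\<forall>p\<in>{1..n}. z p + z (prv n p) \<le> v p"
    using assms by (auto simp: fits_def)
  have "(\<Sum>p\<in>{1..n}. z p + z (prv n p)) \<le> sum v {1..n}" using z(2) by (intro sum_mono) auto
  then show ?thesis using z(1) unfolding sum_add_prv by simp
qed

text \<open>Koenig's theorem for a vertex-weighted path, by greedy matching from the last vertex.\<close>

lemma path_matching_cover:
  "1 \<le> m \<Longrightarrow> \<exists>z C. path_cover m C \<and> z 0 = 0 \<and> z m = (0::nat) \<and> (\<forall>p\<in>{1..m}. z p + z (p - 1) \<le> v p) \<and>
    (\<Sum>p\<in>{1..<m}. z p) = sum v C"
proof (induction m arbitrary: v rule: nat_induct_at_least)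
  case base
  show ?case by (intro exI[of _ "\<lambda>_. 0"] exI[of _ "{}"]) (auto simp: path_cover_def)
next
  case (Suc m)
  \<comment> \<open>With \<open>e\<close> units on the last edge the cover weight must grow by
    exactly \<open>e\<close>. If the cover contains \<open>m\<close>, restoring the capacity of
    \<open>m\<close> does this; otherwise the exhausted end of the edge, of capacity
    \<open>e\<close>, is added.\<close>
  define e where "e = min (v m) (v (Suc m))"
  define v' where "v' = v(m := v m - e)"
  obtain z C where C: "path_cover m C" and z: "z 0 = 0" "z m = 0"
      "\<And>p. p \<in> {1..m} \<Longrightarrow> z p + z (p - 1) \<le> v' p" and eq: "(\<Sum>p\<in>{1..<m}. z p) = sum v' C"
    using Suc.IH[of v'] by blast
  let ?z = "z(m := e, Suc m := 0)"
  have C_sub: "C \<subseteq> {1..m}" and finC: "finite C"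
    using C by (auto simp: path_cover_def intro: finite_subset)
  have fit: "?z p + ?z (p - 1) \<le> v p" if p: "p \<in> {1..Suc m}" for p
  proof -
    consider "p = Suc m" | "p = m" | "p \<in> {1..<m}" using p by fastforce
    then show ?thesis
    proof cases
      case 1
      then show ?thesis by (simp add: e_def)
    next
      case 2
      then show ?thesis using z(3)[of m] z(2) Suc.hyps by (auto simp: v'_def e_def)
    next
      case 3
      then show ?thesis using z(3)[of p] by (auto simp: v'_def)
    qed
  qed
  have sum_z: "(\<Sum>p\<in>{1..<Suc m}. ?z p) = sum v' C + e"
  proof -
    have "(\<Sum>p\<in>{1..<Suc m}. ?z p) = (\<Sum>p\<in>{1..<m}. ?z p) + e"
      using Suc.hyps by (simp add: sum.atLeastLessThan_Suc)
    also have "(\<Sum>p\<in>{1..<m}. ?z p) = (\<Sum>p\<in>{1..<m}. z p)" by (intro sum.cong) auto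
    finally show ?thesis using eq by simp
  qed
  have "\<exists>D. path_cover (Suc m) D \<and> sum v' C + e = sum v D"
  proof (cases "m \<in> C")
    case True
    have "sum v C = v m + sum v (C - {m})" using True finC by (simp add: sum.remove)
    moreover have "sum v' C = v' m + sum v' (C - {m})" using True finC by (simp add: sum.remove)
    moreover have "sum v' (C - {m}) = sum v (C - {m})" by (intro sum.cong) (auto simp: v'_def)
    moreover have "v' m + e = v m" by (simp add: v'_def e_def)
    moreover have "path_cover (Suc m) C" using C True by (auto simp: path_cover_def less_Suc_eq)
    ultimately show ?thesis by (intro exI[of _ C]) simp
  next
    case False
    have eqv: "sum v' C = sum v C" using False by (intro sum.cong) (auto simp: v'_def)
    let ?q = "if v m \<le> v (Suc m) then m else Suc m"
    have "path_cover (Suc m) (insert ?q C)"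
      using C Suc.hyps by (auto simp: path_cover_def less_Suc_eq)
    moreover have "sum v (insert ?q C) = v ?q + sum v C" using False C_sub finC by (subst sum.insert) auto
    moreover have "v ?q = e" by (auto simp: e_def)
    ultimately show ?thesis by (intro exI[of _ "insert ?q C"]) (simp add: eqv)
  qed
  then obtain D where D: "path_cover (Suc m) D" "sum v' C + e = sum v D" by blast
  show ?case
    by (intro exI[of _ ?z] exI[of _ D] conjI ballI fit D(1)) (use z Suc.hyps sum_z D(2) in auto)
qed

section \<open>Covers and packings on the whole cycle\<close>

lemma path_cover_cyc_cover:
  assumes "path_cover n C" "1 \<in> C \<or> n \<in> C"
  shows "cyc_cover n C"
  unfolding cyc_cover_def
proof (intro conjI ballI)
  show "C \<subseteq> {1..n}" using assms by (simp add: path_cover_def)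
  fix p assume p: "p \<in> {1..n}"
  show "p \<in> C \<or> prv n p \<in> C"
  proof (cases "p = 1")
    case False
    then have "p - 1 \<in> {1..<n}" "Suc (p - 1) = p" using p by auto
    then show ?thesis using assms(1) False unfolding path_cover_def prv_def by metis
  qed (use assms in \<open>auto simp: prv_def\<close>)
qed

text \<open>Exchange the two covers beyond a position where this yields two covers of the cycle;
  if there is no such position, the two covers are complementary.\<close>

lemma path_cover_uncross:
  fixes v :: "nat \<Rightarrow> nat"
  assumes D: "path_cover n D" "1 \<notin> D" "n \<notin> D" and E: "path_cover n E" "1 \<in> E" "n \<in> E"
    and covers: "\<And>C. cyc_cover n C \<Longrightarrow> t \<le> sum v C" and deg: "2 * t \<le> sum v {1..n}"
  shows "2 * t \<le> sum v D + sum v E"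
proof -
  have sub: "D \<subseteq> {1..n}" "E \<subseteq> {1..n}" using D E by (auto simp: path_cover_def)
  then have fin: "finite D" "finite E" by (auto intro: finite_subset)
  show ?thesis
  proof (cases "\<exists>p\<in>{1..<n}. (p \<in> E \<or> Suc p \<in> D) \<and> (p \<in> D \<or> Suc p \<in> E)")
    case True
    then obtain p where p: "1 \<le> p" "p < n" "p \<in> E \<or> Suc p \<in> D" "p \<in> D \<or> Suc p \<in> E" by auto
    have swap: "path_cover n ((A \<inter> {..p}) \<union> (B \<inter> {p<..}))"
      if "path_cover n A" "path_cover n B" "p \<in> A \<or> Suc p \<in> B" for A B
      unfolding path_cover_def
    proof (intro conjI ballI)
      show "A \<inter> {..p} \<union> B \<inter> {p<..} \<subseteq> {1..n}" using that by (auto simp: path_cover_def)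
      fix q assume q: "q \<in> {1..<n}"
      consider "q < p" | "q = p" | "p < q" by linarith
      then show "q \<in> A \<inter> {..p} \<union> B \<inter> {p<..} \<or> Suc q \<in> A \<inter> {..p} \<union> B \<inter> {p<..}"
        by cases (use that q in \<open>auto simp: path_cover_def\<close>)
    qed
    have split: "sum v ((A \<inter> {..p}) \<union> (B \<inter> {p<..})) = sum v (A \<inter> {..p}) + sum v (B \<inter> {p<..})"
      if "finite A" "finite B" for A B
      using that by (intro sum.union_disjoint) auto
    have self: "sum v A = sum v (A \<inter> {..p}) + sum v (A \<inter> {p<..})" if "finite A" for A
    proof -
      have "A \<inter> {..p} \<union> A \<inter> {p<..} = A" by auto
      then show ?thesis using split[OF that that] by simp
    qed
    \<comment> \<open>Both hybrids cover the closing edge, since \<open>E\<close> contributes the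
      vertex 1 to one of them and \<open>n\<close> to the other; together they weigh as much as
      \<open>D\<close> and \<open>E\<close>.\<close>
    have "t \<le> sum v ((E \<inter> {..p}) \<union> (D \<inter> {p<..}))" "t \<le> sum v ((D \<inter> {..p}) \<union> (E \<inter> {p<..}))"
      using swap[OF E(1) D(1)] swap[OF D(1) E(1)] p D E
      by (auto intro!: covers path_cover_cyc_cover)
    then show ?thesis
      using split[OF fin] split[OF fin(2,1)] self[OF fin(1)] self[OF fin(2)] by linarith
  next
    case False
    \<comment> \<open>With no exchange possible, membership alternates along the path, so
      \<open>D\<close> and \<open>E\<close> partition the vertices and their total weight is the
      degree. This is where the degree condition enters.\<close>
    have xor: "1 \<le> p \<Longrightarrow> p \<le> n \<longrightarrow> (p \<in> D \<longleftrightarrow> p \<notin> E)" for p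
    proof (induction p rule: nat_induct_at_least)
      case base
      show ?case using D E by simp
    next
      case (Suc p)
      show ?case
      proof
        assume "Suc p \<le> n"
        then have "p \<in> {1..<n}" "p \<in> D \<longleftrightarrow> p \<notin> E" using Suc by auto
        moreover have "p \<in> D \<or> Suc p \<in> D" "p \<in> E \<or> Suc p \<in> E"
          using D(1) E(1) \<open>p \<in> {1..<n}\<close> by (auto simp: path_cover_def)
        ultimately show "Suc p \<in> D \<longleftrightarrow> Suc p \<notin> E" using False by blast
      qed
    qed
    then have "D \<union> E = {1..n}" "D \<inter> E = {}" using sub by auto
    then show ?thesis using sum.union_disjoint[OF fin, of v] deg by simp
  qed
qed

text \<open>Put \<open>c\<close> units on the closing edge and pack the rest along the path, where
  the optimum is the weight of a cover \<open>C\<close> for the reduced capacities. If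
  \<open>C\<close> contains exactly one end of the closing edge, its reduced weight plus
  \<open>c\<close> is its full weight. If it contains both, \<open>c\<close> is lost once, which
  \<open>c \<le> sum v E - t\<close> permits. If it contains neither, \<open>c\<close> must make up
  for \<open>t - sum v C\<close>; each of the three bounds defining \<open>c\<close> is large
  enough, the first by uncrossing \<open>C\<close> with \<open>E\<close>, the other two by adding an
  end to \<open>C\<close>.\<close>

lemma fits_if_covers:
  assumes n: "3 \<le> n" and covers: "\<And>C. cyc_cover n C \<Longrightarrow> t \<le> sum v C" and deg: "2 * t \<le> sum v {1..n}"
  shows "fits n v t"
proof -
  let ?K = "{E. path_cover n E \<and> 1 \<in> E \<and> n \<in> E}"
  have "?K \<subseteq> Pow {1..n}" by (auto simp: path_cover_def)
  then have finK: "finite ?K" by (rule finite_subset) simp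
  have "{1..n} \<in> ?K" using n by (auto simp: path_cover_def)
  then have neK: "?K \<noteq> {}" by blast
  obtain E where E: "path_cover n E" "1 \<in> E" "n \<in> E"
    and minE: "\<And>E'. path_cover n E' \<Longrightarrow> 1 \<in> E' \<Longrightarrow> n \<in> E' \<Longrightarrow> sum v E \<le> sum v E'"
    using arg_min_if_finite[OF finK neK, of "sum v"] by (metis (mono_tags, lifting) mem_Collect_eq not_less)
  have tE: "t \<le> sum v E" using E by (intro covers path_cover_cyc_cover) auto
  define c where "c = min (sum v E - t) (min (v 1) (v n))"
  define v' where "v' = v(1 := v 1 - c, n := v n - c)"
  have c: "c \<le> sum v E - t" "c \<le> v 1" "c \<le> v n" by (auto simp: c_def)
  have v': "v' 1 + c = v 1" "v' n + c = v n" "\<And>p. p \<noteq> 1 \<Longrightarrow> p \<noteq> n \<Longrightarrow> v' p = v p"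
    using n c by (auto simp: v'_def)
  obtain z C where C: "path_cover n C" and z: "z 0 = 0" "z n = 0"
      "\<And>p. p \<in> {1..n} \<Longrightarrow> z p + z (p - 1) \<le> v' p" and eq: "(\<Sum>p\<in>{1..<n}. z p) = sum v' C"
    using path_matching_cover[of n v'] n by auto
  have C_sub: "C \<subseteq> {1..n}" and finC: "finite C"
    using C by (auto simp: path_cover_def intro: finite_subset)
  have sums: "sum v' C + (if 1 \<in> C then c else 0) + (if n \<in> C then c else 0) = sum v C"
  proof -
    have "sum v C = (\<Sum>p\<in>C. v' p + (if p = 1 then c else 0) + (if p = n then c else 0))"
      using v' n by (intro sum.cong) auto
    also have "\<dots> = sum v' C + (if 1 \<in> C then c else 0) + (if n \<in> C then c else 0)"
      using finC by (simp add: sum.distrib)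
    finally show ?thesis by simp
  qed
  have large: "t \<le> sum v' C + c"
  proof (cases "1 \<in> C \<or> n \<in> C")
    case True
    then have "t \<le> sum v C" using C by (intro covers path_cover_cyc_cover) auto
    moreover have "sum v E \<le> sum v C" if "1 \<in> C" "n \<in> C" using minE C that by blast
    ultimately show ?thesis using sums True c(1) tE by (auto split: if_splits)
  next
    case False
    then have eqC: "sum v' C = sum v C" using sums by simp
    have "path_cover n (insert 1 C)" "path_cover n (insert n C)"
      using C n by (auto simp: path_cover_def)
    then have "t \<le> sum v (insert 1 C)" "t \<le> sum v (insert n C)"
      by (auto intro!: covers path_cover_cyc_cover)
    then have "t \<le> v 1 + sum v C" "t \<le> v n + sum v C" using False finC by auto
    moreover have "2 * t \<le> sum v C + sum v E"
      using path_cover_uncross[OF C _ _ E covers deg] False by blast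
    ultimately show ?thesis unfolding eqC c_def using tE by auto
  qed
  let ?z = "z(n := c)"
  have "(\<Sum>p\<in>{1..n}. ?z p) = (\<Sum>p\<in>{1..<n}. ?z p) + c"
    using n by (simp add: sum.last_plus)
  also have "(\<Sum>p\<in>{1..<n}. ?z p) = sum v' C" unfolding eq[symmetric] by (intro sum.cong) auto
  finally have total: "t \<le> (\<Sum>p\<in>{1..n}. ?z p)" using large by simp
  have "?z p + ?z (prv n p) \<le> v p" if p: "p \<in> {1..n}" for p
  proof -
    consider "p = 1" | "p = n" "p \<noteq> 1" | "p \<noteq> 1" "p \<noteq> n" by blast
    then show ?thesis
    proof cases
      case 1
      then show ?thesis using z(3)[of 1] v'(1) n by (simp add: prv_def)
    next
      case 2
      moreover have "n - 1 \<noteq> n" using n by simp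
      ultimately show ?thesis using z(2) z(3)[of n] v'(2) n by (simp add: prv_def)
    next
      case 3
      then have "p - 1 \<noteq> n" using p by auto
      then show ?thesis using 3 z(3)[OF p] v'(3) by (simp add: prv_def)
    qed
  qed
  then show ?thesis unfolding fits_def using total by blast
qed

section \<open>Powers of the edge ideal and their saturations\<close>

definition edge_exp :: "nat \<Rightarrow> nat \<Rightarrow> (nat \<Rightarrow>\<^sub>0 nat)" where
  "edge_exp n e = Poly_Mapping.single e 1 + Poly_Mapping.single (if e = n then 1 else e + 1) 1"

definition cycle_exps :: "nat \<Rightarrow> nat \<Rightarrow> (nat \<Rightarrow>\<^sub>0 nat) set" where
  "cycle_exps n t = mpow n (msum (edge_exp n ` {1..n}) (exps n)) t"

lemma lookup_edge_exp:
  assumes "e \<in> {1..n}"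
  shows "Poly_Mapping.lookup (edge_exp n e) p =
    (if p \<in> {1..n} then (if p = e then 1 else 0) + (if prv n p = e then 1 else 0) else 0)"
  using assms by (auto simp: edge_exp_def lookup_add lookup_single when_def prv_def)

lemma edge_exp_in_exps: "e \<in> {1..n} \<Longrightarrow> edge_exp n e \<in> exps n"
  unfolding edge_exp_def by (intro exps_add) (auto simp: exps_def)

lemma edge_ideal_cycle:
  "edge_ideal n (cycle_edges n) =
    (mono_ideal n (msum (edge_exp n ` {1..n}) (exps n)) :: 'k::field polynomial fract set)"
  if "1 \<le> n"
proof -
  have "{Fract (poly_var i * poly_var j) 1 | i j. {i, j} \<in> cycle_edges n} =
    (monom_fract ` edge_exp n ` {1..n} :: 'k polynomial fract set)" (is "?L = ?M")
  proof
    show "?L \<subseteq> ?M"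
    proof
      fix x :: "'k polynomial fract" assume "x \<in> ?L"
      then obtain i j where ij: "{i, j} \<in> cycle_edges n" and x: "x = Fract (poly_var i * poly_var j) 1"
        by blast
      have x': "x = monom_fract (Poly_Mapping.single i 1 + Poly_Mapping.single j 1)"
        by (simp add: x poly_var_def mult_single)
      obtain e where "e \<in> {1..n}" "edge_exp n e = Poly_Mapping.single i 1 + Poly_Mapping.single j 1"
      proof (cases "{i, j} = {n, 1}")
        case True
        then show ?thesis using that[of n] \<open>1 \<le> n\<close>
          by (auto simp: doubleton_eq_iff edge_exp_def add.commute)
      next
        case False
        then obtain e where "1 \<le> e" "e < n" "{i, j} = {e, e + 1}"
          using ij by (auto simp: cycle_edges_def)
        then show ?thesis using that[of e]
          by (auto simp: doubleton_eq_iff edge_exp_def add.commute)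
      qed
      then show "x \<in> ?M" unfolding x' by (metis imageI)
    qed
    show "?M \<subseteq> ?L"
    proof
      fix x :: "'k polynomial fract" assume "x \<in> ?M"
      then obtain e where e: "e \<in> {1..n}" "x = monom_fract (edge_exp n e)" by blast
      let ?j = "if e = n then 1 else e + 1"
      have "{e, ?j} \<in> cycle_edges n" using e(1) by (auto simp: cycle_edges_def)
      moreover have "x = Fract (poly_var e * poly_var ?j) 1"
        unfolding e(2) edge_exp_def poly_var_def mult_single by simp
      ultimately show "x \<in> ?L" by blast
    qed
  qed
  then show ?thesis
    unfolding edge_ideal_def using edge_exp_in_exps by (simp add: image_subset_iff Idl_monom_fract)
qed

lemma upset_cycle_exps: "upset n (cycle_exps n t)"
  unfolding cycle_exps_def using edge_exp_in_exps by (intro upset_mpow upset_msum upset_exps_self) auto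

lemma cycle_exps_0: "cycle_exps n 0 = exps n"
  and cycle_exps_Suc:
    "cycle_exps n (Suc t) = msum (cycle_exps n t) (msum (edge_exp n ` {1..n}) (exps n))"
  by (simp_all add: cycle_exps_def)

lemma cycle_exps_eq: "cycle_exps n t = {a \<in> exps n. fits n (Poly_Mapping.lookup a) t}"
proof (induction t)
  case 0
  have "fits n v 0" for v unfolding fits_def by (intro exI[of _ "\<lambda>_. 0"]) auto
  then show ?case by (simp add: cycle_exps_0)
next
  case (Suc t)
  show ?case
  proof (intro equalityI subsetI)
    fix a assume a: "a \<in> cycle_exps n (Suc t)"
    then obtain a' e b where ab: "a = a' + (edge_exp n e + b)" "e \<in> {1..n}"
      and "fits n (Poly_Mapping.lookup a') t" unfolding cycle_exps_Suc Suc.IH by (auto simp: msum_def)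
    then obtain z where z: "t \<le> (\<Sum>p\<in>{1..n}. z p)"
      "\<forall>p\<in>{1..n}. z p + z (prv n p) \<le> Poly_Mapping.lookup a' p" by (auto simp: fits_def)
    let ?z = "\<lambda>p. z p + (if p = e then 1 else 0)"
    have "Suc t \<le> (\<Sum>p\<in>{1..n}. ?z p)" using z(1) ab(2) by (simp add: sum.distrib)
    moreover have "\<forall>p\<in>{1..n}. ?z p + ?z (prv n p) \<le> Poly_Mapping.lookup a p"
      using z(2) by (auto simp: ab(1) lookup_add lookup_edge_exp[OF ab(2)])
    moreover have "a \<in> exps n" using a upset_exps[OF upset_cycle_exps] by blast
    ultimately show "a \<in> {a \<in> exps n. fits n (Poly_Mapping.lookup a) (Suc t)}"
      unfolding fits_def by blast
  next
    fix a assume "a \<in> {a \<in> exps n. fits n (Poly_Mapping.lookup a) (Suc t)}"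
    then obtain z where a: "a \<in> exps n" and z: "Suc t \<le> (\<Sum>p\<in>{1..n}. z p)"
      "\<And>p. p \<in> {1..n} \<Longrightarrow> z p + z (prv n p) \<le> Poly_Mapping.lookup a p" by (auto simp: fits_def)
    have "\<exists>e\<in>{1..n}. z e \<noteq> 0"
    proof (rule ccontr)
      assume "\<not> (\<exists>e\<in>{1..n}. z e \<noteq> 0)"
      then have "(\<Sum>p\<in>{1..n}. z p) = 0" by simp
      then show False using z(1) by simp
    qed
    then obtain e where e: "e \<in> {1..n}" "z e \<noteq> 0" by blast
    let ?z = "\<lambda>p. z p - (if p = e then 1 else 0)"
    let ?a = "a - edge_exp n e"
    \<comment> \<open>This inequality shows both that the truncated subtraction of the edge loses
      nothing and that the reduced multiplicities fit the reduced capacities.\<close>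
    have le: "Poly_Mapping.lookup (edge_exp n e) p + (?z p + ?z (prv n p)) \<le> Poly_Mapping.lookup a p"
      if "p \<in> {1..n}" for p
      using z(2)[OF that] e(2) that by (auto simp: lookup_edge_exp[OF e(1)])
    have "a = ?a + edge_exp n e"
    proof (rule poly_mapping_eqI)
      fix p
      show "Poly_Mapping.lookup a p = Poly_Mapping.lookup (?a + edge_exp n e) p"
        using le[of p] by (cases "p \<in> {1..n}") (auto simp: lookup_add lookup_minus lookup_edge_exp[OF e(1)])
    qed
    moreover have "?a \<in> exps n"
    proof -
      have "Poly_Mapping.keys ?a \<subseteq> Poly_Mapping.keys a" by (auto simp: in_keys_iff lookup_minus)
      then show ?thesis using a by (auto simp: exps_def)
    qed
    moreover have "fits n (Poly_Mapping.lookup ?a) t"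
    proof -
      have "(\<Sum>p\<in>{1..n}. z p) = (\<Sum>p\<in>{1..n}. ?z p + (if p = e then 1 else 0))"
        using e(2) by (intro sum.cong) auto
      also have "\<dots> = (\<Sum>p\<in>{1..n}. ?z p) + 1" unfolding sum.distrib using e(1) by simp
      finally have "t \<le> (\<Sum>p\<in>{1..n}. ?z p)" using z(1) by simp
      moreover have "\<forall>p\<in>{1..n}. ?z p + ?z (prv n p) \<le> Poly_Mapping.lookup ?a p"
        using le by (fastforce simp: lookup_minus)
      ultimately show ?thesis unfolding fits_def by (intro exI[of _ ?z]) blast
    qed
    moreover have "edge_exp n e \<in> msum (edge_exp n ` {1..n}) (exps n)"
      unfolding msum_def using e(1) by (intro CollectI exI[of _ "edge_exp n e"] exI[of _ 0]) simp
    ultimately show "a \<in> cycle_exps n (Suc t)"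
      unfolding cycle_exps_Suc Suc.IH msum_def[of "{a \<in> exps n. fits n (Poly_Mapping.lookup a) t}"] by blast
  qed
qed

section \<open>Vertex covers under saturation, and the even cycle\<close>

lemma saturation_cover:
  assumes n: "2 \<le> n" and a: "a \<in> saturation n (cycle_exps n t)" and C: "cyc_cover n C"
  shows "t \<le> sum (Poly_Mapping.lookup a) C"
proof -
  obtain k where aex: "a \<in> exps n"
    and k: "\<And>b. b \<in> exps n \<Longrightarrow> k \<le> mdeg n b \<Longrightarrow> a + b \<in> cycle_exps n t"
    using a by (auto simp: saturation_def)
  have proper: "t \<le> sum (Poly_Mapping.lookup a) C"
    if C: "cyc_cover n C" and j: "j \<in> {1..n}" "j \<notin> C" for C j
  proof -
    let ?b = "Poly_Mapping.single j k"
    have "?b \<in> exps n" using j by (auto simp: exps_def)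
    moreover have "k \<le> mdeg n ?b" using j by (simp add: mdeg_def lookup_single when_def)
    ultimately have "fits n (Poly_Mapping.lookup (a + ?b)) t" using k by (simp add: cycle_exps_eq)
    then have "t \<le> sum (Poly_Mapping.lookup (a + ?b)) C" using C by (rule fits_cover)
    also have "\<dots> = sum (Poly_Mapping.lookup a) C"
      using j by (intro sum.cong) (auto simp: lookup_add lookup_single when_def)
    finally show ?thesis .
  qed
  show ?thesis
  proof (cases "C = {1..n}")
    case True
    \<comment> \<open>The full vertex set leaves no capacity free to be raised, but dropping the
      vertex 1 still leaves a cover, of no larger weight.\<close>
    have "cyc_cover n ({1..n} - {1})" using n by (auto simp: cyc_cover_def prv_def)
    from proper[OF this, of 1] n have "t \<le> sum (Poly_Mapping.lookup a) ({1..n} - {1})" by simp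
    also have "\<dots> \<le> sum (Poly_Mapping.lookup a) C" unfolding True by (intro sum_mono2) auto
    finally show ?thesis .
  next
    case False
    moreover have "C \<subseteq> {1..n}" using C by (simp add: cyc_cover_def)
    ultimately obtain j where "j \<in> {1..n}" "j \<notin> C" by blast
    then show ?thesis by (rule proper[OF C])
  qed
qed

lemma saturation_cycle_exps_even:
  assumes n: "3 \<le> n" "even n"
  shows "saturation n (cycle_exps n t) = cycle_exps n t"
proof (rule antisym)
  show "saturation n (cycle_exps n t) \<subseteq> cycle_exps n t"
  proof
    fix a assume a: "a \<in> saturation n (cycle_exps n t)"
    have covers: "t \<le> sum (Poly_Mapping.lookup a) C" if "cyc_cover n C" for C
      using saturation_cover[OF _ a that] n by simp
    let ?O = "{p \<in> {1..n}. odd p}" and ?E = "{p \<in> {1..n}. even p}"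
    have "cyc_cover n ?O" "cyc_cover n ?E" using n by (auto simp: cyc_cover_def prv_def)
    then have "2 * t \<le> sum (Poly_Mapping.lookup a) ?O + sum (Poly_Mapping.lookup a) ?E"
      using covers[of ?O] covers[of ?E] by simp
    also have "\<dots> = sum (Poly_Mapping.lookup a) (?O \<union> ?E)" by (rule sum.union_disjoint[symmetric]) auto
    also have "?O \<union> ?E = {1..n}" by auto
    finally have "fits n (Poly_Mapping.lookup a) t" using n(1) covers by (intro fits_if_covers)
    then show "a \<in> cycle_exps n t" using a by (simp add: cycle_exps_eq saturation_def)
  qed
qed (rule subset_saturation[OF upset_cycle_exps])

section \<open>The extra monomials on an odd cycle\<close>

text \<open>The values alternate in sign, and going once around an odd cycle gives
  \<open>x 1 = - x 1\<close>. Hence vertex loads determine the edge multiplicities, which is the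
  source of all uniqueness claims for odd \<open>n\<close>.\<close>

lemma alternating_zero:
  fixes x :: "nat \<Rightarrow> int"
  assumes "odd n" and x: "\<And>p. p \<in> {1..n} \<Longrightarrow> x p + x (prv n p) = 0" and p: "p \<in> {1..n}"
  shows "x p = 0"
proof -
  have n: "1 \<le> n" using \<open>odd n\<close> by (cases n) auto
  have alt: "1 \<le> p \<Longrightarrow> p \<le> n \<longrightarrow> x p = (if odd p then x 1 else - x 1)" for p
  proof (induction p rule: nat_induct_at_least)
    case (Suc p)
    then show ?case using x[of "Suc p"] by (auto simp: prv_def)
  qed simp
  have "x 1 + x n = 0" using x[of 1] n by (simp add: prv_def)
  moreover have "x n = x 1" using alt[of n] n \<open>odd n\<close> by simp
  ultimately show ?thesis using alt[of p] p by auto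
qed

text \<open>Each edge uses two units of capacity, so a total capacity of \<open>2 * t\<close> leaves
  no slack at any vertex.\<close>

lemma fits_tight:
  assumes "fits n v t" "sum v {1..n} = 2 * t"
  shows "\<exists>z. \<forall>p\<in>{1..n}. z p + z (prv n p) = v p"
proof -
  obtain z where z: "t \<le> (\<Sum>p\<in>{1..n}. z p)" "\<And>p. p \<in> {1..n} \<Longrightarrow> z p + z (prv n p) \<le> v p"
    using assms by (auto simp: fits_def)
  have "(\<Sum>p\<in>{1..n}. z p + z (prv n p)) \<le> sum v {1..n}" using z(2) by (intro sum_mono) auto
  then have "(\<Sum>p\<in>{1..n}. z p + z (prv n p)) = sum v {1..n}"
    using z(1) assms(2) unfolding sum_add_prv by simp
  then have "z p + z (prv n p) = v p" if "p \<in> {1..n}" for p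
    using sum_mono_inv[of "\<lambda>p. z p + z (prv n p)" "{1..n}" v p] z(2) that by auto
  then show ?thesis by blast
qed

text \<open>The exponent of the product of all variables to the power \<open>d\<close>, times the
  edges with multiplicities \<open>y\<close>.\<close>

definition cone_exp :: "nat \<Rightarrow> nat \<Rightarrow> (nat \<Rightarrow> nat) \<Rightarrow> (nat \<Rightarrow>\<^sub>0 nat)" where
  "cone_exp n d y = (\<Sum>p\<in>{1..n}. Poly_Mapping.single p (d + y p + y (prv n p)))"

lemma lookup_cone_exp:
  "Poly_Mapping.lookup (cone_exp n d y) p = (if p \<in> {1..n} then d + y p + y (prv n p) else 0)"
  by (simp add: cone_exp_def lookup_sum lookup_single when_def)

lemma mdeg_cone_exp: "mdeg n (cone_exp n d y) = n * d + 2 * (\<Sum>p\<in>{1..n}. y p)"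
proof -
  have "mdeg n (cone_exp n d y) = (\<Sum>p\<in>{1..n}. d + (y p + y (prv n p)))"
    unfolding mdeg_def by (intro sum.cong) (auto simp: lookup_cone_exp)
  also have "\<dots> = n * d + 2 * (\<Sum>p\<in>{1..n}. y p)"
    by (subst sum.distrib, subst sum_add_prv) simp
  finally show ?thesis .
qed

lemma cone_exp_in_exps: "cone_exp n d y \<in> exps n"
  unfolding exps_def by (auto simp: in_keys_iff lookup_cone_exp split: if_splits)

text \<open>The degree is \<open>2 * t - d\<close>, too small for the power itself. Multiplication
  by a monomial of degree at least \<open>n * d\<close> adds at least \<open>d\<close> at some
  vertex \<open>j\<close>. Capacity \<open>d\<close> everywhere with an extra \<open>d\<close> at
  \<open>j\<close> holds \<open>(n + 1) div 2 * d\<close> edges: a cover of an odd cycle has at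
  least \<open>(n + 1) div 2\<close> vertices, and the degree condition holds with equality.\<close>

lemma cone_exp_in_saturation:
  assumes n: "3 \<le> n" "odd n" and d: "1 \<le> d" and t: "(\<Sum>p\<in>{1..n}. y p) + (n + 1) div 2 * d = t"
  shows "cone_exp n d y \<in> saturation n (cycle_exps n t) - cycle_exps n t"
proof
  have two: "2 * ((n + 1) div 2) = n + 1" using n(2) by simp
  have "2 * t = 2 * (\<Sum>p\<in>{1..n}. y p) + 2 * ((n + 1) div 2) * d" using t by (simp add: algebra_simps)
  then have t2: "2 * t = 2 * (\<Sum>p\<in>{1..n}. y p) + n * d + d" by (simp only: two) simp
  show "cone_exp n d y \<notin> cycle_exps n t"
  proof
    assume "cone_exp n d y \<in> cycle_exps n t"
    then have "fits n (Poly_Mapping.lookup (cone_exp n d y)) t" by (simp add: cycle_exps_eq)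
    from fits_degree[OF this] have "2 * t \<le> mdeg n (cone_exp n d y)" unfolding mdeg_def .
    then show False using t2 d unfolding mdeg_cone_exp by simp
  qed
  have "cone_exp n d y + b \<in> cycle_exps n t" if b: "b \<in> exps n" "n * d \<le> mdeg n b" for b
  proof -
    have "\<exists>j\<in>{1..n}. d \<le> Poly_Mapping.lookup b j"
    proof (rule ccontr)
      assume "\<not> ?thesis"
      then have "(\<Sum>p\<in>{1..n}. Poly_Mapping.lookup b p) < (\<Sum>p\<in>{1..n}. d)"
        using n(1) by (intro sum_strict_mono) (auto simp: not_le)
      then show False using b(2) by (simp add: mdeg_def)
    qed
    then obtain j where j: "j \<in> {1..n}" "d \<le> Poly_Mapping.lookup b j" by blast
    let ?v = "\<lambda>p. d + (if p = j then d else 0)"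
    have "fits n ?v ((n + 1) div 2 * d)"
    proof (rule fits_if_covers[OF n(1)])
      fix C assume C: "cyc_cover n C"
      \<comment> \<open>Multiplicity 1 on all edges loads every vertex with 2.\<close>
      have "n \<le> 2 * card C" using cyc_cover_le_sum[OF C, of "\<lambda>_. 1"] by simp
      then have "(n + 1) div 2 \<le> card C" using n(2) by presburger
      then have "(n + 1) div 2 * d \<le> (\<Sum>p\<in>C. d)" by simp
      also have "\<dots> \<le> sum ?v C" by (intro sum_mono) simp
      finally show "(n + 1) div 2 * d \<le> sum ?v C" .
    next
      have "sum ?v {1..n} = (n + 1) * d" using j(1) by (simp add: sum.distrib)
      then show "2 * ((n + 1) div 2 * d) \<le> sum ?v {1..n}" using two by (metis mult.assoc order_refl)
    qed
    then obtain z where z: "(n + 1) div 2 * d \<le> (\<Sum>p\<in>{1..n}. z p)"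
      "\<And>p. p \<in> {1..n} \<Longrightarrow> z p + z (prv n p) \<le> ?v p" by (auto simp: fits_def)
    have "t \<le> (\<Sum>p\<in>{1..n}. z p + y p)" using z(1) t by (simp add: sum.distrib)
    moreover have "\<forall>p\<in>{1..n}. (z p + y p) + (z (prv n p) + y (prv n p))
        \<le> Poly_Mapping.lookup (cone_exp n d y + b) p"
    proof
      fix p assume p: "p \<in> {1..n}"
      have "(if p = j then d else 0) \<le> Poly_Mapping.lookup b p" using j(2) by simp
      then show "(z p + y p) + (z (prv n p) + y (prv n p)) \<le> Poly_Mapping.lookup (cone_exp n d y + b) p"
        using z(2)[OF p] p unfolding lookup_add lookup_cone_exp by simp
    qed
    ultimately have "fits n (Poly_Mapping.lookup (cone_exp n d y + b)) t"
      unfolding fits_def by (intro exI[of _ "\<lambda>p. z p + y p"]) blast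
    then show ?thesis using b(1) cone_exp_in_exps by (simp add: cycle_exps_eq exps_add)
  qed
  then show "cone_exp n d y \<in> saturation n (cycle_exps n t)"
    unfolding saturation_def using cone_exp_in_exps by blast
qed

text \<open>Adding the deficit \<open>d = 2t - |a|\<close> at a single vertex \<open>j\<close> makes \<open>a\<close> perfectly
  matchable. Subtracting \<open>d\<close> times the matching of the closed walk that starts and ends at \<open>j\<close> leaves
  the unique solution \<open>y\<close> of \<open>y p + y (prv n p) = a p - d\<close>, which is nonnegative off
  that matching. The vertices \<open>j = 1, 2, 3\<close> cover all positions.\<close>

lemma saturation_minus_cycle_exps:
  assumes n: "3 \<le> n" "odd n" and a: "a \<in> saturation n (cycle_exps n t)" "a \<notin> cycle_exps n t"
  shows "\<exists>d y. 1 \<le> d \<and> (\<Sum>p\<in>{1..n}. y p) + (n + 1) div 2 * d = t \<and> a = cone_exp n d y"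
proof -
  let ?a = "Poly_Mapping.lookup a"
  have covers: "t \<le> sum ?a C" if "cyc_cover n C" for C
    using saturation_cover[OF _ a(1) that] n by simp
  have aex: "a \<in> exps n" using a(1) by (simp add: saturation_def)
  have deg: "sum ?a {1..n} < 2 * t"
  proof (rule ccontr)
    assume "\<not> ?thesis"
    then have "fits n ?a t" by (intro fits_if_covers[OF n(1)] covers) simp_all
    then show False using a(2) aex by (simp add: cycle_exps_eq)
  qed
  define d where "d = 2 * t - sum ?a {1..n}"
  have d: "1 \<le> d" "sum ?a {1..n} + d = 2 * t" using deg by (auto simp: d_def)
  have ex: "\<exists>z. \<forall>p\<in>{1..n}. z p + z (prv n p) = ?a p + (if p = j then d else 0)" if "j \<in> {1..n}" for j
  proof (rule fits_tight)
    show eq: "(\<Sum>p\<in>{1..n}. ?a p + (if p = j then d else 0)) = 2 * t"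
      using that d by (simp add: sum.distrib)
    show "fits n (\<lambda>p. ?a p + (if p = j then d else 0)) t"
    proof (rule fits_if_covers[OF n(1)])
      fix C assume "cyc_cover n C"
      then have "t \<le> sum ?a C" by (rule covers)
      also have "\<dots> \<le> (\<Sum>p\<in>C. ?a p + (if p = j then d else 0))" by (intro sum_mono) simp
      finally show "t \<le> (\<Sum>p\<in>C. ?a p + (if p = j then d else 0))" .
    qed (simp only: eq)
  qed
  obtain z1 where z1: "\<forall>p\<in>{1..n}. z1 p + z1 (prv n p) = ?a p + (if p = 1 then d else 0)"
    using ex[of 1] n by auto
  obtain z2 where z2: "\<forall>p\<in>{1..n}. z2 p + z2 (prv n p) = ?a p + (if p = 2 then d else 0)"
    using ex[of 2] n by auto
  obtain z3 where z3: "\<forall>p\<in>{1..n}. z3 p + z3 (prv n p) = ?a p + (if p = 3 then d else 0)"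
    using ex[of 3] n by auto
  \<comment> \<open>The subtracted edge sets are {1, 3, ..., n}, {1, 2, 4, ..., n-1} and {2, 3, 5,
    ..., n}. Each meets every vertex once, except that it meets vertex 1, 2 or 3, respectively,
    twice. So the three differences solve the same system and coincide. Off its set each difference
    is a natural number, and no edge lies in all three sets.\<close>
  define x1 where "x1 p = int (z1 p) - (if odd p then int d else 0)" for p
  define x2 where "x2 p = int (z2 p) - (if p = 1 \<or> even p then int d else 0)" for p
  define x3 where "x3 p = int (z3 p) - (if p = 2 \<or> odd p \<and> 3 \<le> p then int d else 0)" for p
  have x1: "x1 p + x1 (prv n p) = int (?a p) - int d" if p: "p \<in> {1..n}" for p
  proof -
    have "int (z1 p) + int (z1 (prv n p)) = int (?a p) + (if p = 1 then int d else 0)"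
      using bspec[OF z1 p] by (simp flip: of_nat_add)
    then show ?thesis using n p by (auto simp: x1_def prv_def)
  qed
  have x2: "x2 p + x2 (prv n p) = int (?a p) - int d" if p: "p \<in> {1..n}" for p
  proof -
    define m where "m p = (if p = 1 \<or> even p then int d else 0)" for p :: nat
    have "int (z2 p) + int (z2 (prv n p)) = int (?a p) + (if p = 2 then int d else 0)"
      using bspec[OF z2 p] by (simp flip: of_nat_add)
    moreover have "m p + m (prv n p) = int d + (if p = 2 then int d else 0)"
    proof -
      consider "p = 1" | "p = 2" | "3 \<le> p"
        using p by force
      then show ?thesis
      proof cases
        case 3
        then obtain q where "p = Suc q" by (cases p) auto
        then show ?thesis using 3 by (auto simp: m_def prv_def)
      qed (use n in \<open>simp_all add: m_def prv_def\<close>)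
    qed
    ultimately show ?thesis by (simp add: x2_def m_def)
  qed
  have x3: "x3 p + x3 (prv n p) = int (?a p) - int d" if p: "p \<in> {1..n}" for p
  proof -
    define m where "m p = (if p = 2 \<or> odd p \<and> 3 \<le> p then int d else 0)" for p :: nat
    have "int (z3 p) + int (z3 (prv n p)) = int (?a p) + (if p = 3 then int d else 0)"
      using bspec[OF z3 p] by (simp flip: of_nat_add)
    moreover have "m p + m (prv n p) = int d + (if p = 3 then int d else 0)"
    proof -
      consider "p = 1" | "p = 2" | "p = 3" | "4 \<le> p"
        using p by force
      then show ?thesis
      proof cases
        case 4
        then obtain q where "p = Suc q" by (cases p) auto
        then show ?thesis using 4 by (auto simp: m_def prv_def)
      qed (use n in \<open>simp_all add: m_def prv_def\<close>)
    qed
    ultimately show ?thesis by (simp add: x3_def m_def)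
  qed
  have x12: "x1 p = x2 p" if "p \<in> {1..n}" for p
  proof -
    have "x1 p - x2 p = 0"
    proof (rule alternating_zero[OF n(2) _ that])
      fix q assume "q \<in> {1..n}"
      from x1[OF this] x2[OF this] show "x1 q - x2 q + (x1 (prv n q) - x2 (prv n q)) = 0" by linarith
    qed
    then show ?thesis by simp
  qed
  have x13: "x1 p = x3 p" if "p \<in> {1..n}" for p
  proof -
    have "x1 p - x3 p = 0"
    proof (rule alternating_zero[OF n(2) _ that])
      fix q assume "q \<in> {1..n}"
      from x1[OF this] x3[OF this] show "x1 q - x3 q + (x1 (prv n q) - x3 (prv n q)) = 0" by linarith
    qed
    then show ?thesis by simp
  qed
  have nonneg: "0 \<le> x1 p" if p: "p \<in> {1..n}" for p
  proof -
    consider "even p" | "odd p" "3 \<le> p" | "p = 1" using p by (cases "p = 1 \<or> p = 2") auto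
    then show ?thesis
    proof cases
      case 1
      then show ?thesis by (simp add: x1_def)
    next
      case 2
      then show ?thesis using x12[OF p] by (simp add: x2_def)
    next
      case 3
      then show ?thesis using x13[OF p] by (simp add: x3_def)
    qed
  qed
  define y where "y p = nat (x1 p)" for p
  have prv_in: "prv n p \<in> {1..n}" if "p \<in> {1..n}" for p using that by (auto simp: prv_def)
  have y: "d + y p + y (prv n p) = ?a p" if p: "p \<in> {1..n}" for p
    using x1[OF p] nonneg[OF p] nonneg[OF prv_in[OF p]] unfolding y_def by linarith
  have eq: "a = cone_exp n d y"
  proof (rule poly_mapping_eqI)
    fix p
    show "?a p = Poly_Mapping.lookup (cone_exp n d y) p"
    proof (cases "p \<in> {1..n}")
      case False
      then have "p \<notin> Poly_Mapping.keys a" using aex by (auto simp: exps_def)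
      then show ?thesis unfolding lookup_cone_exp if_not_P[OF False] by (simp add: in_keys_iff)
    qed (simp add: lookup_cone_exp y)
  qed
  have "mdeg n a + d = 2 * t" using d(2) by (simp add: mdeg_def)
  then have "2 * (\<Sum>p\<in>{1..n}. y p) + (n + 1) * d = 2 * t" by (simp add: eq mdeg_cone_exp)
  moreover have "n + 1 = 2 * ((n + 1) div 2)" using n(2) by simp
  ultimately have "2 * ((\<Sum>p\<in>{1..n}. y p) + (n + 1) div 2 * d) = 2 * t"
    by (metis add_mult_distrib2 mult.assoc)
  then show ?thesis using d(1) eq by (intro exI[of _ d] exI[of _ y]) simp
qed

text \<open>The parameter \<open>s\<close> will be \<open>(n + 1) div 2\<close>. Multiplicities are
  lists rather than functions, so that each monomial has only one parameter and lists of given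
  length and sum can be counted.\<close>

definition cone_params :: "nat \<Rightarrow> nat \<Rightarrow> nat \<Rightarrow> (nat \<times> nat list) set" where
  "cone_params n s t = {(d, l). 1 \<le> d \<and> length l = n \<and> sum_list l + s * d = t}"

lemma sum_nth_shift: "length l = n \<Longrightarrow> (\<Sum>p\<in>{1..n}. l ! (p - 1)) = sum_list (l :: nat list)"
  by (simp add: sum_list_sum_nth sum.atLeast1_atMost_eq atLeast0LessThan)

text \<open>For injectivity, \<open>d\<close> is recovered as \<open>2 * t\<close> minus the degree,
  after which the loads determine the multiplicities by \<open>alternating_zero\<close>. Positions
  start at 1 and list indices at 0, hence \<open>p - 1\<close>.\<close>

lemma saturation_cycle_exps_odd:
  assumes n: "3 \<le> n" "odd n"
  shows "bij_betw (\<lambda>(d, l). cone_exp n d (\<lambda>p. l ! (p - 1))) (cone_params n ((n + 1) div 2) t)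
    (saturation n (cycle_exps n t) - cycle_exps n t)"
proof (rule bij_betw_imageI)
  let ?f = "\<lambda>(d, l). cone_exp n d (\<lambda>p. l ! (p - 1))"
  show "inj_on ?f (cone_params n ((n + 1) div 2) t)"
  proof (rule inj_onI, clarify)
    fix d l d' l'
    assume dl: "(d, l) \<in> cone_params n ((n + 1) div 2) t" "(d', l') \<in> cone_params n ((n + 1) div 2) t"
      and eq: "cone_exp n d (\<lambda>p. l ! (p - 1)) = cone_exp n d' (\<lambda>p. l' ! (p - 1))"
    have len: "length l = n" "length l' = n" using dl by (auto simp: cone_params_def)
    have two: "2 * ((n + 1) div 2) = n + 1" using n(2) by simp
    have deg: "mdeg n (cone_exp n d (\<lambda>p. l ! (p - 1))) + d = 2 * t"
      if "(d, l) \<in> cone_params n ((n + 1) div 2) t" for d l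
    proof -
      have "2 * sum_list l + 2 * ((n + 1) div 2) * d = 2 * t" "length l = n"
        using that by (auto simp: cone_params_def)
      then show ?thesis unfolding mdeg_cone_exp two by (simp add: sum_nth_shift[symmetric, of l n])
    qed
    have d: "d = d'" using deg[OF dl(1)] deg[OF dl(2)] eq by simp
    have "int (l ! (p - 1)) - int (l' ! (p - 1)) = 0" if "p \<in> {1..n}" for p
    proof (rule alternating_zero[OF n(2) _ that])
      fix q assume "q \<in> {1..n}"
      then have "l ! (q - 1) + l ! (prv n q - 1) = l' ! (q - 1) + l' ! (prv n q - 1)"
        using arg_cong[OF eq, of "\<lambda>a. Poly_Mapping.lookup a q"] d by (simp add: lookup_cone_exp)
      then show "int (l ! (q - 1)) - int (l' ! (q - 1)) + (int (l ! (prv n q - 1)) - int (l' ! (prv n q - 1))) = 0"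
        by linarith
    qed
    from this[of "Suc _"] have "l ! i = l' ! i" if "i < n" for i using that by simp
    then show "d = d' \<and> l = l'" using d len by (auto intro: nth_equalityI)
  qed
  show "?f ` cone_params n ((n + 1) div 2) t = saturation n (cycle_exps n t) - cycle_exps n t"
  proof (intro equalityI subsetI)
    fix a assume "a \<in> ?f ` cone_params n ((n + 1) div 2) t"
    then obtain d l where dl: "1 \<le> d" "length l = n" "sum_list l + (n + 1) div 2 * d = t"
      and a: "a = cone_exp n d (\<lambda>p. l ! (p - 1))" by (auto simp: cone_params_def)
    show "a \<in> saturation n (cycle_exps n t) - cycle_exps n t"
      unfolding a using dl(3) by (intro cone_exp_in_saturation n dl(1)) (simp only: sum_nth_shift[OF dl(2)])
  next
    fix a assume "a \<in> saturation n (cycle_exps n t) - cycle_exps n t"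
    then obtain d y where dy: "1 \<le> d" "(\<Sum>p\<in>{1..n}. y p) + (n + 1) div 2 * d = t" "a = cone_exp n d y"
      using saturation_minus_cycle_exps[OF n] by blast
    define l where "l = map (\<lambda>i. y (Suc i)) [0..<n]"
    have l: "l ! (p - 1) = y p" if "p \<in> {1..n}" for p using that by (auto simp: l_def)
    have len: "length l = n" by (simp add: l_def)
    have "sum_list l = (\<Sum>p\<in>{1..n}. y p)"
      unfolding sum_nth_shift[OF len, symmetric] by (rule sum.cong[OF refl l])
    moreover have "cone_exp n d (\<lambda>p. l ! (p - 1)) = a"
      unfolding dy(3) cone_exp_def
    proof (rule sum.cong[OF refl])
      fix p assume "p \<in> {1..n}"
      moreover from this have "prv n p \<in> {1..n}" by (auto simp: prv_def)
      ultimately show "Poly_Mapping.single p (d + l ! (p - 1) + l ! (prv n p - 1)) =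
        Poly_Mapping.single p (d + y p + y (prv n p))" using l by metis
    qed
    ultimately show "a \<in> ?f ` cone_params n ((n + 1) div 2) t"
      using dy(1,2) len by (intro image_eqI[of _ _ "(d, l)"]) (auto simp: cone_params_def)
  qed
qed

section \<open>Counting\<close>

lemma finite_lists_sum: "finite {l :: nat list. length l = n \<and> sum_list l = m}"
proof (rule finite_subset)
  show "{l :: nat list. length l = n \<and> sum_list l = m} \<subseteq> {l. set l \<subseteq> {..m} \<and> length l = n}"
    using member_le_sum_list by fastforce
  show "finite {l. set l \<subseteq> {..m} \<and> length l = n}" by (rule finite_lists_length_eq) simp
qed

text \<open>Split off the parameters with \<open>d = 1\<close>, whose lists have sum
  \<open>t - s\<close>; lowering \<open>d\<close> by one maps the others onto the parameters for
  \<open>t - s\<close>.\<close>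

lemma cone_params_rec:
  assumes "1 \<le> s"
  shows "finite (cone_params n s t) \<and> card (cone_params n s t) =
    (if s \<le> t then ((t - s + n - 1) choose (t - s)) + card (cone_params n s (t - s)) else 0)"
  using assms
proof (induction t rule: less_induct)
  case (less t)
  show ?case
  proof (cases "s \<le> t")
    case False
    have "cone_params n s t = {}"
    proof (rule ccontr)
      assume "cone_params n s t \<noteq> {}"
      then obtain d l where d: "1 \<le> d" and t: "sum_list l + s * d = t" by (auto simp: cone_params_def)
      have "s * 1 \<le> s * d" using d by (rule mult_le_mono2)
      also have "s * d \<le> t" using t by linarith
      finally have "s \<le> t" by simp
      then show False using False by simp
    qed
    then show ?thesis using False by simp
  next
    case True
    let ?L = "{l. length l = n \<and> sum_list l = t - s}"
    let ?P = "cone_params n s (t - s)"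
    have fin: "finite ?P" using less.IH[of "t - s"] True less.prems by simp
    have eq: "cone_params n s t = Pair 1 ` ?L \<union> (\<lambda>(d, l). (Suc d, l)) ` ?P"
    proof (intro equalityI subsetI)
      fix x assume "x \<in> cone_params n s t"
      then obtain d l where x: "x = (d, l)" "1 \<le> d" "length l = n" "sum_list l + s * d = t"
        by (auto simp: cone_params_def)
      show "x \<in> Pair 1 ` ?L \<union> (\<lambda>(d, l). (Suc d, l)) ` ?P"
      proof (cases "d = 1")
        case True
        then show ?thesis using x by auto
      next
        case False
        then obtain e where e: "d = Suc e" "1 \<le> e" using x(2) by (cases d) auto
        then have "(e, l) \<in> ?P" using x by (auto simp: cone_params_def)
        then show ?thesis using x(1) e(1) by force
      qed
    next
      fix x assume "x \<in> Pair 1 ` ?L \<union> (\<lambda>(d, l). (Suc d, l)) ` ?P"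
      then show "x \<in> cone_params n s t" using True by (auto simp: cone_params_def)
    qed
    have "card (cone_params n s t) = card (Pair (1::nat) ` ?L) + card ((\<lambda>(d, l). (Suc d, l)) ` ?P)"
      unfolding eq using fin finite_lists_sum by (intro card_Un_disjoint) (auto simp: cone_params_def)
    also have "card (Pair (1::nat) ` ?L) = (t - s + n - 1) choose (t - s)"
      by (subst card_image) (auto simp: inj_on_def card_length_sum_list)
    also have "card ((\<lambda>(d, l). (Suc d, l)) ` ?P) = card ?P" by (rule card_image) (auto simp: inj_on_def)
    finally show ?thesis using True fin finite_lists_sum by (simp add: eq)
  qed
qed

text \<open>The recursion makes the cardinality a sum of values of the monotone function
  \<open>f\<close> at points spaced by \<open>s\<close>. Each value times \<open>s\<close> lies
  between the sums of \<open>f\<close> over the block just below that point and the block of length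
  \<open>s\<close> starting at it, as in a comparison with an integral.\<close>

lemma card_cone_params_bounds:
  assumes s: "1 \<le> s" and n: "1 \<le> n"
  shows "(t - s + n - 1) choose n \<le> s * card (cone_params n s t) \<and>
    s * card (cone_params n s t) \<le> (t + n - 1) choose n"
proof -
  define f where "f m = (m + n - 1) choose (n - 1)" for m
  have f_eq: "(m + n - 1) choose m = f m" for m
    using n binomial_symmetric[of m "m + n - 1"] by (simp add: f_def)
  have f_mono: "f m \<le> f m'" if "m \<le> m'" for m m'
    unfolding f_def using that by (intro binomial_right_mono) simp
  \<comment> \<open>The hockey-stick identity, which turns the block sums into one binomial
    coefficient.\<close>
  have F: "(\<Sum>m<t. f m) = (t + n - 1) choose n" for t
  proof (induction t)
    case 0
    show ?case using n by (simp add: binomial_eq_0)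
  next
    case (Suc t)
    obtain k where k: "n = Suc k" using n by (cases n) auto
    show ?case using Suc.IH by (simp add: f_def k)
  qed
  have split: "(\<Sum>m<t. f m) = (\<Sum>m<t - s. f m) + (\<Sum>m\<in>{t - s..<t}. f m)" for t
    by (subst sum.union_disjoint[symmetric]) (auto intro!: sum.cong)
  have "(\<Sum>m<t - s. f m) \<le> s * card (cone_params n s t) \<and>
    s * card (cone_params n s t) \<le> (\<Sum>m<t. f m)"
  proof (induction t rule: less_induct)
    case (less t)
    show ?case
    proof (cases "s \<le> t")
      case True
      have card: "card (cone_params n s t) = f (t - s) + card (cone_params n s (t - s))"
        using cone_params_rec[OF s, of n t] True by (simp only: f_eq if_True)
      have "(\<Sum>m\<in>{t - s..<t}. f (t - s)) \<le> (\<Sum>m\<in>{t - s..<t}. f m)"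
        by (intro sum_mono f_mono) auto
      then have up: "s * f (t - s) \<le> (\<Sum>m\<in>{t - s..<t}. f m)" using True by simp
      have "(\<Sum>m\<in>{t - s - s..<t - s}. f m) \<le> (\<Sum>m\<in>{t - s - s..<t - s}. f (t - s))"
        by (intro sum_mono f_mono) auto
      also have "\<dots> = ((t - s) - (t - s - s)) * f (t - s)" by simp
      \<comment> \<open>Near zero the block is truncated and may have fewer than \<open>s\<close>
        elements.\<close>
      also have "\<dots> \<le> s * f (t - s)" by (rule mult_le_mono1) arith
      finally have low: "(\<Sum>m\<in>{t - s - s..<t - s}. f m) \<le> s * f (t - s)" .
      have "t - s < t" using True s by simp
      from less.IH[OF this] show ?thesis
        using up low split[of t] split[of "t - s"] unfolding card add_mult_distrib2 by linarith
    next
      case False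
      then show ?thesis using cone_params_rec[OF s, of n t] by simp
    qed
  qed
  then show ?thesis by (simp only: F)
qed

section \<open>Asymptotics of the count\<close>

lemma binomial_over_power_tendsto:
  assumes n: "1 \<le> n"
  shows "(\<lambda>t. real ((t - s + n - 1) choose n) / real t ^ n) \<longlonglongrightarrow> 1 / fact n"
proof -
  have "(\<lambda>t. \<Prod>i\<in>{0..<n}. (real t - real s + real i) / real t) \<longlonglongrightarrow> (\<Prod>i\<in>{0..<n}. 1)"
  proof (rule tendsto_prod)
    fix i
    have "(\<lambda>t. 1 + (real i - real s) * (1 / real t)) \<longlonglongrightarrow> 1 + (real i - real s) * 0"
      by (intro tendsto_intros lim_1_over_n)
    then have "(\<lambda>t. 1 + (real i - real s) * (1 / real t)) \<longlonglongrightarrow> 1" by simp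
    moreover have "\<forall>\<^sub>F t in sequentially.
        1 + (real i - real s) * (1 / real t) = (real t - real s + real i) / real t"
      using eventually_gt_at_top[of 0] by eventually_elim (simp add: field_simps)
    ultimately show "(\<lambda>t. (real t - real s + real i) / real t) \<longlonglongrightarrow> 1"
      by (rule Lim_transform_eventually)
  qed
  then have "(\<lambda>t. (\<Prod>i\<in>{0..<n}. (real t - real s + real i) / real t) / fact n) \<longlonglongrightarrow> 1 / fact n"
    by (intro tendsto_divide) auto
  moreover have "\<forall>\<^sub>F t in sequentially. (\<Prod>i\<in>{0..<n}. (real t - real s + real i) / real t) / fact n =
    real ((t - s + n - 1) choose n) / real t ^ n"
    using eventually_ge_at_top[of s]
  proof eventually_elim
    case (elim t)
    \<comment> \<open>For \<open>t \<ge> s\<close> the subtraction is not truncated, and the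
      binomial coefficient is a product of \<open>n\<close> factors \<open>t - s + i\<close>, each
      asymptotic to \<open>t\<close>, over \<open>fact n\<close>.\<close>
    have "real ((t - s + n - 1) choose n) = pochhammer (real t - real s) n / fact n"
      using n elim by (simp add: binomial_gbinomial gbinomial_pochhammer' of_nat_diff)
    also have "pochhammer (real t - real s) n = (\<Prod>i\<in>{0..<n}. real t - real s + real i)"
      by (rule pochhammer_prod)
    finally show ?case by (simp add: prod_dividef)
  qed
  ultimately show ?thesis by (rule Lim_transform_eventually)
qed

lemma card_cone_params_tendsto:
  assumes s: "1 \<le> s" and n: "1 \<le> n"
  shows "(\<lambda>t. real (card (cone_params n s t)) / real t ^ n) \<longlonglongrightarrow> 1 / (real s * fact n)"
proof (rule tendsto_sandwich)
  have "(\<lambda>t. real ((t - s + n - 1) choose n) / real t ^ n / real s) \<longlonglongrightarrow> 1 / fact n / real s"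
    using s by (intro tendsto_divide binomial_over_power_tendsto n tendsto_const) auto
  then show "(\<lambda>t. real ((t - s + n - 1) choose n) / real t ^ n / real s) \<longlonglongrightarrow> 1 / (real s * fact n)"
    by (simp add: mult.commute)
  have "(\<lambda>t. real ((t - 0 + n - 1) choose n) / real t ^ n / real s) \<longlonglongrightarrow> 1 / fact n / real s"
    using s by (intro tendsto_divide binomial_over_power_tendsto n tendsto_const) auto
  then show "(\<lambda>t. real ((t + n - 1) choose n) / real t ^ n / real s) \<longlonglongrightarrow> 1 / (real s * fact n)"
    by (simp add: mult.commute)
  have "real ((t - s + n - 1) choose n) / real t ^ n / real s \<le> real (card (cone_params n s t)) / real t ^ n"
    and "real (card (cone_params n s t)) / real t ^ n \<le> real ((t + n - 1) choose n) / real t ^ n / real s" for t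
  proof -
    have b: "real ((t - s + n - 1) choose n) \<le> real s * real (card (cone_params n s t))"
      "real s * real (card (cone_params n s t)) \<le> real ((t + n - 1) choose n)"
      using card_cone_params_bounds[OF s n, of t] by (metis of_nat_le_iff of_nat_mult)+
    have "real ((t - s + n - 1) choose n) / real s \<le> real (card (cone_params n s t))"
      "real (card (cone_params n s t)) \<le> real ((t + n - 1) choose n) / real s"
      using b s by (auto simp: field_simps)
    then show "real ((t - s + n - 1) choose n) / real t ^ n / real s \<le> real (card (cone_params n s t)) / real t ^ n"
      "real (card (cone_params n s t)) / real t ^ n \<le> real ((t + n - 1) choose n) / real t ^ n / real s"
      using divide_right_mono[of _ _ "real t ^ n"] by (metis (no_types) divide_divide_eq_left mult.commute zero_le_power of_nat_0_le_iff)+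
  qed
  then show "\<forall>\<^sub>F t in sequentially. real ((t - s + n - 1) choose n) / real t ^ n / real s
      \<le> real (card (cone_params n s t)) / real t ^ n"
    "\<forall>\<^sub>F t in sequentially. real (card (cone_params n s t)) / real t ^ n
      \<le> real ((t + n - 1) choose n) / real t ^ n / real s" by (auto intro: always_eventually)
qed

section \<open>From the count to the multiplicity\<close>

lemma eps_multiplicity_cycle:
  assumes n: "1 \<le> n"
    and fin: "\<And>t. finite (saturation n (cycle_exps n t) - cycle_exps n t)"
    and lim: "(\<lambda>t. real (card (saturation n (cycle_exps n t) - cycle_exps n t)) / real t ^ n) \<longlonglongrightarrow> L"
  shows "eps_multiplicity (local_poly_ring n)
    (edge_ideal n (cycle_edges n) :: 'k::field polynomial fract set) = ereal (fact n * L)"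
proof -
  let ?R = "local_poly_ring n :: 'k polynomial fract ring"
  let ?I = "edge_ideal n (cycle_edges n) :: 'k polynomial fract set"
  let ?c = "\<lambda>t. card (saturation n (cycle_exps n t) - cycle_exps n t)"
  have upI: "upset n (msum (edge_exp n ` {1..n}) (exps n))"
    using edge_exp_in_exps by (intro upset_msum upset_exps_self) auto
  have len: "module_length ?R (local_coho n (ideal_power ?R ?I t)) = enat (?c t)" for t
    unfolding edge_ideal_cycle[OF n] ideal_power_mono_ideal[OF upI] cycle_exps_def[symmetric]
    by (rule module_length_local_coho[OF upset_cycle_exps fin])
  have "((\<lambda>t. ereal (real (?c t) / real t ^ n)) \<longlongrightarrow> ereal L) sequentially"
    using lim by simp
  \<comment> \<open>For positive \<open>t\<close> the quotient of extended reals is a quotient of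
    reals; \<open>t = 0\<close> does not affect the limit.\<close>
  moreover have "\<forall>\<^sub>F t in sequentially. ereal (real (?c t) / real t ^ n) =
      ereal_of_enat (module_length ?R (local_coho n (ideal_power ?R ?I t))) / ereal (real t ^ n)"
    using eventually_gt_at_top[of 0] by eventually_elim (simp add: len)
  ultimately have "((\<lambda>t. ereal_of_enat (module_length ?R (local_coho n (ideal_power ?R ?I t)))
      / ereal (real t ^ n)) \<longlongrightarrow> ereal L) sequentially"
    by (rule Lim_transform_eventually)
  then have "limsup (\<lambda>t. ereal_of_enat (module_length ?R (local_coho n (ideal_power ?R ?I t)))
      / ereal (real t ^ n)) = ereal L"
    by (intro lim_imp_Limsup) simp_all
  then show ?thesis
    unfolding eps_multiplicity_def by (simp add: krull_dim_local_poly_ring Let_def)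
qed

theorem proposition10p4:
  fixes n :: nat
  assumes "n \<ge> 3"
  shows "(even n \<longrightarrow>
            eps_multiplicity (local_poly_ring n)
              (edge_ideal n (cycle_edges n) :: 'k::field polynomial fract set) = 0) \<and>
         (odd n \<longrightarrow>
            eps_multiplicity (local_poly_ring n)
              (edge_ideal n (cycle_edges n) :: 'k::field polynomial fract set) = ereal (2 / (real n + 1)))"
proof (intro conjI impI)
  assume "even n"
  have "eps_multiplicity (local_poly_ring n)
      (edge_ideal n (cycle_edges n) :: 'k polynomial fract set) = ereal (fact n * 0)"
    using assms by (intro eps_multiplicity_cycle) (simp_all add: saturation_cycle_exps_even \<open>even n\<close>)
  then show "eps_multiplicity (local_poly_ring n)
      (edge_ideal n (cycle_edges n) :: 'k polynomial fract set) = 0" by (simp add: zero_ereal_def)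
next
  assume "odd n"
  let ?s = "(n + 1) div 2"
  have s: "1 \<le> ?s" "real ?s = (real n + 1) / 2" using assms \<open>odd n\<close> by (auto elim!: oddE)
  note bij = saturation_cycle_exps_odd[OF assms \<open>odd n\<close>]
  have "eps_multiplicity (local_poly_ring n)
      (edge_ideal n (cycle_edges n) :: 'k polynomial fract set) = ereal (fact n * (1 / (real ?s * fact n)))"
  proof (rule eps_multiplicity_cycle)
    show "finite (saturation n (cycle_exps n t) - cycle_exps n t)" for t
      using bij_betw_finite[OF bij] cone_params_rec[OF s(1)] by blast
    show "(\<lambda>t. real (card (saturation n (cycle_exps n t) - cycle_exps n t)) / real t ^ n)
        \<longlonglongrightarrow> 1 / (real ?s * fact n)"
      using card_cone_params_tendsto[OF s(1), of n] assms by (simp only: bij_betw_same_card[OF bij])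
  qed (use assms in simp)
  \<comment> \<open>The normalising factorial cancels the one from the count, leaving the reciprocal
    of the minimal size of a vertex cover.\<close>
  also have "fact n * (1 / (real ?s * fact n)) = 2 / (real n + 1)" unfolding s(2) by simp
  finally show "eps_multiplicity (local_poly_ring n)
      (edge_ideal n (cycle_edges n) :: 'k polynomial fract set) = ereal (2 / (real n + 1))" .
qed

end
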